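(* Let $P\in\mathcal{P}(\mathbb{X})$, let $\xi_1,\xi_2,\dots$ be i.i.d. $\mathbb{X}$-valued random variables with law $P$, and let $P_n(B)=\frac1n\sum_{i=1}^n1_{\{\xi_i\in B\}}$ ($B\subset\mathbb{X}$ Borel) be the empirical measures. Suppose that: (a) the transition kernel $\mathcal{T}(\cdot|x,u)$ is weakly continuous in $(x,u)$; (b) the channel $Q$ is continuous in total variation, i.e. $\|Q(\cdot|x_n)-Q(\cdot|x)\|_{TV}\to0$ whenever $x_n\to x$; (c) the stage-wise cost function $c:\mathbb{X}\times\mathbb{U}\to\mathbb{R}$ is non-negative, bounded and continuous on $\mathbb{X}\times\mathbb{U}$; (d) $\mathbb{U}$ is compact. Let $\gamma_n^*\in\Gamma$ be an optimal policy for the estimated prior $P_n$, i.e. $J_\beta(P_n,\mathcal{T},\gamma_n^* )=J_\beta^*(P_n,\mathcal{T})$. Then, almost surely, as $n\to\infty$, $$J_\beta^*(P_n,\mathcal{T})\to J_\beta^*(P,\mathcal{T})\qquad\text{and}\qquad J_\beta(P,\mathcal{T},\gamma_n^* )\to J_\beta^*(P,\mathcal{T}).$$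
   Context: $\mathbb{X}\subset\mathbb{R}^n$, $\mathbb{Y}\subset\mathbb{R}^m$ and $\mathbb{U}$ (a subset of some Euclidean space) are Borel sets; $\mathcal{P}(\mathbb{X})$ is the set of Borel probability measures on $\mathbb{X}$. $Q(\cdot|x)$ (the channel) is a stochastic kernel from $\mathbb{X}$ to $\mathbb{Y}$ and $\mathcal{T}(\cdot|x,u)$ is a stochastic kernel from $\mathbb{X}\times\mathbb{U}$ to $\mathbb{X}$; weak continuity of $\mathcal{T}$ means $(x,u)\mapsto\int g(x_1)\mathcal{T}(dx_1|x,u)$ is continuous for every bounded continuous $g$. An admissible policy is a sequence $\gamma=\{\gamma_t\}_{t\ge0}$ of measurable control functions with $U_t=\gamma_t(I_t)\in\mathbb{U}$, where $I_0=\{Y_0\}$, $I_t=\{Y_0,\dots,Y_t,U_0,\dots,U_{t-1}\}$; $\Gamma$ is the set of admissible policies. Given an initial law (prior) $P\in\mathcal{P}(\mathbb{X})$ and $\gamma\in\Gamma$, the process evolves as $X_0\sim P$, $Y_t\sim Q(\cdot|X_t)$ and $X_{t+1}\sim\mathcal{T}(\cdot|X_t,U_t)$ (conditionally on the past); $E_P^{\gamma}$ is the corresponding expectation. For fixed $\beta\in(0,1)$, $$J_\beta(P,\mathcal{T},\gamma)=E_P^{\gamma}\Big[\sum_{t=0}^\infty\beta^tc(X_t,U_t)\Big],\qquad J_\beta^*(P,\mathcal{T})=\inf_{\gamma\in\Gamma}J_\beta(P,\mathcal{T},\gamma),$$ with $Q$ fixed. In $J_\beta(P,\mathcal{T},\gamma_n^*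 )$ the (sample-dependent) policy $\gamma_n^*$ is treated as fixed when taking the expectation. The total variation distance is $\|\mu-\nu\|_{TV}=2\sup_B|\mu(B)-\nu(B)|$ over Borel sets $B$. *)

theory Defs
  imports "HOL-Probability.Probability"
begin

abbreviation borel_on :: "'a::topological_space set \<Rightarrow> 'a measure" where
  "borel_on A \<equiv> restrict_space borel A"

definition tv_dist :: "'a measure \<Rightarrow> 'a measure \<Rightarrow> real" where
  "tv_dist \<mu> \<nu> = 2 * (SUP B\<in>sets \<mu>. \<bar>measure \<mu> B - measure \<nu> B\<bar>)"

definition tv_continuous ::
    "'x::topological_space set \<Rightarrow> ('x \<Rightarrow> 'y measure) \<Rightarrow> bool" where
  "tv_continuous X Q \<longleftrightarrow>
     (\<forall>x\<in>X. \<forall>xs. (\<forall>n. xs n \<in> X) \<longrightarrow> xs \<longlonglongrightarrow> x \<longrightarrow>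
        (\<lambda>n::nat. tv_dist (Q (xs n)) (Q x)) \<longlonglongrightarrow> 0)"

definition weakly_continuous ::
    "'x::topological_space set \<Rightarrow> 'u::topological_space set \<Rightarrow> ('x \<Rightarrow> 'u \<Rightarrow> 'x measure) \<Rightarrow> bool" where
  "weakly_continuous X U T \<longleftrightarrow>
     (\<forall>g::'x \<Rightarrow> real. continuous_on X g \<longrightarrow> bounded (g ` X) \<longrightarrow>
        continuous_on (X \<times> U) (\<lambda>(x, u). \<integral>x1. g x1 \<partial>T x u))"

text \<open>A policy \<open>\<gamma>\<close> maps the time \<open>t\<close>, the observations \<open>y\<^sub>0, \<dots>, y\<^sub>t\<close> (an extensional function on
  \<open>{..t}\<close>) and the past actions \<open>u\<^sub>0, \<dots>, u\<^bsub>t-1\<^esub>\<close> (an extensional function on \<open>{..<t}\<close>) to an action.\<close>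

type_synonym ('y, 'u) policy = "nat \<Rightarrow> (nat \<Rightarrow> 'y) \<Rightarrow> (nat \<Rightarrow> 'u) \<Rightarrow> 'u"

definition admissible_policies ::
    "'y::topological_space set \<Rightarrow> 'u::topological_space set \<Rightarrow> ('y, 'u) policy set" where
  "admissible_policies Y U =
     {\<gamma>. \<forall>t. (\<lambda>(ys, us). \<gamma> t ys us) \<in>
            PiM {..t} (\<lambda>_. borel_on Y) \<Otimes>\<^sub>M PiM {..<t} (\<lambda>_. borel_on U) \<rightarrow>\<^sub>M borel_on U}"

text \<open>A trajectory is a sequence of triples \<open>(X\<^sub>t, Y\<^sub>t, U\<^sub>t)\<close>.\<close>

definition state :: "'x \<times> 'y \<times> 'u \<Rightarrow> 'x" where "state = (\<lambda>(x, y, u). x)"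
definition obs :: "'x \<times> 'y \<times> 'u \<Rightarrow> 'y" where "obs = (\<lambda>(x, y, u). y)"
definition action :: "'x \<times> 'y \<times> 'u \<Rightarrow> 'u" where "action = (\<lambda>(x, y, u). u)"

abbreviation stage_space ::
    "'x::topological_space set \<Rightarrow> 'y::topological_space set \<Rightarrow> 'u::topological_space set \<Rightarrow>
     ('x \<times> 'y \<times> 'u) measure" where
  "stage_space X Y U \<equiv> borel_on X \<Otimes>\<^sub>M (borel_on Y \<Otimes>\<^sub>M borel_on U)"

text \<open>The conditional law of the triple at time \<open>t\<close> given the history \<open>h\<close> of the triples at the
  times \<open>0, \<dots>, t - 1\<close>.\<close>

definition stage_kernel ::
    "'x::topological_space set \<Rightarrow> 'y::topological_space set \<Rightarrow> 'u::topological_space set \<Rightarrow>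
     ('x \<Rightarrow> 'y measure) \<Rightarrow> ('x \<Rightarrow> 'u \<Rightarrow> 'x measure) \<Rightarrow> 'x measure \<Rightarrow> ('y, 'u) policy \<Rightarrow>
     nat \<Rightarrow> (nat \<Rightarrow> 'x \<times> 'y \<times> 'u) \<Rightarrow> ('x \<times> 'y \<times> 'u) measure" where
  "stage_kernel X Y U Q T P \<gamma> t h =
     do {
       x \<leftarrow> (if t = 0 then P else T (state (h (t - 1))) (action (h (t - 1))));
       y \<leftarrow> Q x;
       return (stage_space X Y U)
         (x, y, \<gamma> t (\<lambda>i\<in>{..t}. if i < t then obs (h i) else y) (\<lambda>i\<in>{..<t}. action (h i)))
     }"

text \<open>The law of the trajectory is the Ionescu-Tulcea measure of the stage kernels.  The library
  constants are total, but only meaningful under the assumptions of the locale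
  \<open>Ionescu_Tulcea\<close>; these are verified in \<open>Ionescu_Tulcea_stage_kernel\<close> below.\<close>

definition trajectory_law ::
    "'x::topological_space set \<Rightarrow> 'y::topological_space set \<Rightarrow> 'u::topological_space set \<Rightarrow>
     ('x \<Rightarrow> 'y measure) \<Rightarrow> ('x \<Rightarrow> 'u \<Rightarrow> 'x measure) \<Rightarrow> 'x measure \<Rightarrow> ('y, 'u) policy \<Rightarrow>
     (nat \<Rightarrow> 'x \<times> 'y \<times> 'u) measure" where
  "trajectory_law X Y U Q T P \<gamma> =
     projective_family.lim UNIV
       (Ionescu_Tulcea.CI (stage_kernel X Y U Q T P \<gamma>) (\<lambda>_. stage_space X Y U))
       (\<lambda>_. stage_space X Y U)"

definition discounted_cost ::
    "'x::topological_space set \<Rightarrow> 'y::topological_space set \<Rightarrow> 'u::topological_space set \<Rightarrow>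
     ('x \<Rightarrow> 'y measure) \<Rightarrow> ('x \<Rightarrow> 'u \<Rightarrow> real) \<Rightarrow> real \<Rightarrow>
     'x measure \<Rightarrow> ('x \<Rightarrow> 'u \<Rightarrow> 'x measure) \<Rightarrow> ('y, 'u) policy \<Rightarrow> real" where
  "discounted_cost X Y U Q c \<beta> P T \<gamma> =
     (\<integral>\<omega>. (\<Sum>t. \<beta> ^ t * c (state (\<omega> t)) (action (\<omega> t))) \<partial>trajectory_law X Y U Q T P \<gamma>)"

definition optimal_cost ::
    "'x::topological_space set \<Rightarrow> 'y::topological_space set \<Rightarrow> 'u::topological_space set \<Rightarrow>
     ('x \<Rightarrow> 'y measure) \<Rightarrow> ('x \<Rightarrow> 'u \<Rightarrow> real) \<Rightarrow> real \<Rightarrow>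
     'x measure \<Rightarrow> ('x \<Rightarrow> 'u \<Rightarrow> 'x measure) \<Rightarrow> real" where
  "optimal_cost X Y U Q c \<beta> P T =
     (INF \<gamma>\<in>admissible_policies Y U. discounted_cost X Y U Q c \<beta> P T \<gamma>)"

definition optimal_policy ::
    "'x::topological_space set \<Rightarrow> 'y::topological_space set \<Rightarrow> 'u::topological_space set \<Rightarrow>
     ('x \<Rightarrow> 'y measure) \<Rightarrow> ('x \<Rightarrow> 'u \<Rightarrow> real) \<Rightarrow> real \<Rightarrow>
     'x measure \<Rightarrow> ('x \<Rightarrow> 'u \<Rightarrow> 'x measure) \<Rightarrow> ('y, 'u) policy \<Rightarrow> bool" where
  "optimal_policy X Y U Q c \<beta> P T \<gamma> \<longleftrightarrow>
     \<gamma> \<in> admissible_policies Y U \<and>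
     discounted_cost X Y U Q c \<beta> P T \<gamma> = optimal_cost X Y U Q c \<beta> P T"

text \<open>The empirical measure of the points \<open>xs 1, \<dots>, xs n\<close>.\<close>

definition empirical_measure ::
    "'x::topological_space set \<Rightarrow> nat \<Rightarrow> (nat \<Rightarrow> 'x) \<Rightarrow> 'x measure" where
  "empirical_measure X n xs =
     measure_of X (sets (borel_on X)) (\<lambda>B. ennreal ((\<Sum>i=1..n. indicator B (xs i)) / real n))"

lemma emeasure_empirical_measure:
  assumes B: "B \<in> sets (borel_on X)"
  shows "emeasure (empirical_measure X n xs) B =
    ennreal ((\<Sum>i=1..n. indicator B (xs i)) / real n)"
proof -
  have eq: "ennreal ((\<Sum>i=1..n. indicator A (xs i)) / real n) =
      ennreal (1 / real n) * (\<Sum>i=1..n. indicator A (xs i))" for A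
  proof -
    have "(\<Sum>i=1..n. indicator A (xs i) :: ennreal) = ennreal (\<Sum>i=1..n. indicator A (xs i))"
      by (subst sum_ennreal[symmetric]) (auto simp: ennreal_indicator)
    then show ?thesis
      by (simp add: ennreal_mult'[symmetric])
  qed
  show ?thesis
  proof (rule emeasure_measure_of[OF empirical_measure_def])
    show "sets (borel_on X) \<subseteq> Pow X"
      using sets.sets_into_space[of _ "borel_on X"] by (auto simp: space_restrict_space)
    have S: "sets (empirical_measure X n xs) = sets (borel_on X)"
      using sets.sigma_sets_eq[of "borel_on X"] \<open>sets (borel_on X) \<subseteq> Pow X\<close>
      by (simp add: empirical_measure_def space_restrict_space)
    show "B \<in> sets (empirical_measure X n xs)"
      using B S by simp
    show "positive (sets (empirical_measure X n xs))
        (\<lambda>B. ennreal ((\<Sum>i=1..n. indicator B (xs i)) / real n))"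
      by (simp add: positive_def)
    show "countably_additive (sets (empirical_measure X n xs))
        (\<lambda>B. ennreal ((\<Sum>i=1..n. indicator B (xs i)) / real n))"
      unfolding countably_additive_def eq
      by (auto simp: ennreal_suminf_cmult suminf_sum suminf_indicator)
  qed
qed

lemma empirical_measure_in_prob_algebra:
  assumes "n \<ge> 1" "\<And>i. i \<in> {1..n} \<Longrightarrow> xs i \<in> X"
  shows "empirical_measure X n xs \<in> space (prob_algebra (borel_on X))"
proof -
  have sub: "sets (borel_on X) \<subseteq> Pow X"
    using sets.sets_into_space[of _ "borel_on X"] by (auto simp: space_restrict_space)
  have sets: "sets (empirical_measure X n xs) = sets (borel_on X)"
    using sets.sigma_sets_eq[of "borel_on X"] sub
    by (simp add: empirical_measure_def space_restrict_space)
  have sp: "space (empirical_measure X n xs) = X"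
    using sub by (simp add: empirical_measure_def)
  have "X \<in> sets (borel_on X)"
    using sets.top[of "borel_on X"] by (simp add: space_restrict_space)
  moreover have "(\<Sum>i=1..n. indicator X (xs i) :: real) = real n"
    using assms(2) by simp
  ultimately have "prob_space (empirical_measure X n xs)"
    using assms(1) by (intro prob_spaceI) (simp add: sp emeasure_empirical_measure)
  then show ?thesis
    by (simp add: space_prob_algebra sets)
qed

lemma Ionescu_Tulcea_stage_kernel:
  assumes P[measurable]: "P \<in> space (prob_algebra (borel_on X))"
    and Q[measurable]: "Q \<in> borel_on X \<rightarrow>\<^sub>M prob_algebra (borel_on Y)"
    and T[measurable]: "(\<lambda>(x, u). T x u) \<in> borel_on X \<Otimes>\<^sub>M borel_on U \<rightarrow>\<^sub>M prob_algebra (borel_on X)"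
    and \<gamma>: "\<gamma> \<in> admissible_policies Y U"
  shows "Ionescu_Tulcea (stage_kernel X Y U Q T P \<gamma>) (\<lambda>_. stage_space X Y U)"
proof -
  have [measurable]: "(\<lambda>(ys, us). \<gamma> t ys us) \<in>
      PiM {..t} (\<lambda>_. borel_on Y) \<Otimes>\<^sub>M PiM {..<t} (\<lambda>_. borel_on U) \<rightarrow>\<^sub>M borel_on U" for t
    using \<gamma> by (auto simp: admissible_policies_def)
  have [measurable]:
    "state \<in> stage_space X Y U \<rightarrow>\<^sub>M borel_on X"
    "obs \<in> stage_space X Y U \<rightarrow>\<^sub>M borel_on Y"
    "action \<in> stage_space X Y U \<rightarrow>\<^sub>M borel_on U"
    unfolding state_def obs_def action_def by measurable
  have K: "stage_kernel X Y U Q T P \<gamma> t \<in>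
      PiM {0..<t} (\<lambda>_. stage_space X Y U) \<rightarrow>\<^sub>M prob_algebra (stage_space X Y U)" for t
  proof -
    let ?H = "PiM {0..<t} (\<lambda>_. stage_space X Y U)"
    let ?ys = "\<lambda>h y. \<lambda>i\<in>{..t}. if i < t then obs (h i) else y"
    let ?us = "\<lambda>h. \<lambda>i\<in>{..<t}. action (h i)"
    have A: "(\<lambda>h. if t = 0 then P else T (state (h (t - 1))) (action (h (t - 1)))) \<in>
        ?H \<rightarrow>\<^sub>M prob_algebra (borel_on X)"
    proof (cases "t = 0")
      case True
      then show ?thesis using P by simp
    next
      case False
      then have [measurable]: "(\<lambda>h. h (t - 1)) \<in> ?H \<rightarrow>\<^sub>M stage_space X Y U"
        by (intro measurable_component_singleton) auto
      have "(\<lambda>h. (\<lambda>(x, u). T x u) (state (h (t - 1)), action (h (t - 1)))) \<in>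
          ?H \<rightarrow>\<^sub>M prob_algebra (borel_on X)"
        by measurable
      with False show ?thesis by simp
    qed
    have ys: "(\<lambda>((h, x), y). ?ys h y) \<in>
        (?H \<Otimes>\<^sub>M borel_on X) \<Otimes>\<^sub>M borel_on Y \<rightarrow>\<^sub>M PiM {..t} (\<lambda>_. borel_on Y)"
      unfolding split_beta'
    proof (rule measurable_restrict)
      fix i assume "i \<in> {..t}"
      show "(\<lambda>p. if i < t then obs (fst (fst p) i) else snd p) \<in>
          (?H \<Otimes>\<^sub>M borel_on X) \<Otimes>\<^sub>M borel_on Y \<rightarrow>\<^sub>M borel_on Y"
        by (cases "i < t") simp_all
    qed
    have us: "(\<lambda>((h, x), y). ?us h) \<in>
        (?H \<Otimes>\<^sub>M borel_on X) \<Otimes>\<^sub>M borel_on Y \<rightarrow>\<^sub>M PiM {..<t} (\<lambda>_. borel_on U)"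
      unfolding split_beta' by (rule measurable_restrict) simp
    have B: "(\<lambda>p. (snd (fst p), snd p, \<gamma> t (?ys (fst (fst p)) (snd p)) (?us (fst (fst p))))) \<in>
        (?H \<Otimes>\<^sub>M borel_on X) \<Otimes>\<^sub>M borel_on Y \<rightarrow>\<^sub>M stage_space X Y U"
    proof -
      have "(\<lambda>p. (\<lambda>(ys, us). \<gamma> t ys us) ((\<lambda>((h, x), y). ?ys h y) p, (\<lambda>((h, x), y). ?us h) p)) \<in>
          (?H \<Otimes>\<^sub>M borel_on X) \<Otimes>\<^sub>M borel_on Y \<rightarrow>\<^sub>M borel_on U"
        by (rule measurable_compose[OF measurable_Pair[OF ys us]]) measurable
      then have "(\<lambda>p. \<gamma> t (?ys (fst (fst p)) (snd p)) (?us (fst (fst p)))) \<in>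
          (?H \<Otimes>\<^sub>M borel_on X) \<Otimes>\<^sub>M borel_on Y \<rightarrow>\<^sub>M borel_on U"
        by (simp only: split_beta' fst_conv snd_conv)
      then show ?thesis
        by (intro measurable_Pair) simp_all
    qed
    show ?thesis
      unfolding stage_kernel_def
      apply (rule measurable_bind_prob_space2[OF A])
      apply (subst split_beta')
      apply (rule measurable_bind_prob_space2[where N = "borel_on Y"])
       apply (rule measurable_compose[OF measurable_snd Q])
      apply (subst split_beta')
      apply (rule measurable_compose[OF B measurable_return_prob_space])
      done
  qed
  show ?thesis
  proof (rule Ionescu_Tulcea.intro)
    fix i :: nat
    show "stage_kernel X Y U Q T P \<gamma> i \<in>
        PiM {0..<i} (\<lambda>_. stage_space X Y U) \<rightarrow>\<^sub>M subprob_algebra (stage_space X Y U)"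
      by (rule measurable_prob_algebraD[OF K])
  next
    fix i :: nat and h
    assume "h \<in> space (PiM {0..<i} (\<lambda>_. stage_space X Y U))"
    then show "prob_space (stage_kernel X Y U Q T P \<gamma> i h)"
      using measurable_space[OF K] by (simp add: space_prob_algebra)
  qed
qed

end

(* For a fixed policy the cost is an average over the initial state of conditional costs, and only
   finitely many stages matter up to a small error because of discounting.  The N-stage conditional
   costs, as functions of the state x and taken over all policies and all past observations and
   actions, form an equicontinuous family F_N.  Indeed, integrals of an equicontinuous bounded
   family against the weakly continuous kernel T are equicontinuous in (x, u), hence uniformly so
   in u over the compact set U, and continuity of Q in total variation handles the dependence of
   the observation on x, whatever measurable policy is applied to it.  Weak convergence of the
   priors is uniform on equicontinuous bounded families, and is tested there by countably many
   functions, for which Hoeffding's inequality and the Borel-Cantelli lemma give almost sure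
   convergence of the empirical means.  So the costs converge uniformly over all policies, which
   yields both limits. *)

theory Submission
  imports Defs
begin

section \<open>Equicontinuous families\<close>

text \<open>If P has no atoms, every empirical measure is at maximal total variation distance from
  it, so the priors can only be compared weakly. Convergence policy by policy would not suffice
  either, because the optimal policy changes with n and with the sample; hence the uniformity over
  policies. A policy is merely measurable in the observations, so the future cost can be an
  irregular function of y. Weak continuity of Q would say nothing about its integrals, whereas total
  variation controls all bounded measurable integrands at once. Two states remain comparable because
  an action is a function of observations and past actions and never of the state: at a fixed
  observation the same action is taken from both, and only c and T feel the change of x. Which
  action this is cannot be controlled, and this is why continuity in x has to be uniform over
  U.\<close>

definition equicontinuous_on :: "'a::metric_space set \<Rightarrow> ('a \<Rightarrow> real) set \<Rightarrow> bool" where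
  "equicontinuous_on S F \<longleftrightarrow>
     (\<forall>x\<in>S. \<forall>e>0. \<forall>\<^sub>F y in at x within S. \<forall>f\<in>F. \<bar>f y - f x\<bar> < e)"

lemma equicontinuous_onD:
  assumes "equicontinuous_on S F" "x \<in> S" "e > 0"
  shows "\<forall>\<^sub>F y in at x within S. \<forall>f\<in>F. \<bar>f y - f x\<bar> < e"
  using assms by (auto simp: equicontinuous_on_def)

lemma equicontinuous_on_ball:
  assumes "equicontinuous_on S F" "x \<in> S" "e > 0"
  obtains d where "d > 0" "\<And>y f. y \<in> S \<Longrightarrow> dist y x < d \<Longrightarrow> f \<in> F \<Longrightarrow> \<bar>f y - f x\<bar> < e"
proof -
  obtain d where d: "d > 0" "\<And>y. y \<in> S \<Longrightarrow> y \<noteq> x \<Longrightarrow> dist y x < d \<Longrightarrow> \<forall>f\<in>F. \<bar>f y - f x\<bar> < e"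
    using equicontinuous_onD[OF assms] unfolding eventually_at by blast
  show thesis
  proof (rule that[OF d(1)])
    fix y f assume "y \<in> S" "dist y x < d" "f \<in> F"
    with d(2)[of y] \<open>e > 0\<close> show "\<bar>f y - f x\<bar> < e" by (cases "y = x") auto
  qed
qed

lemma equicontinuous_on_continuous_on:
  assumes "equicontinuous_on S F" "f \<in> F"
  shows "continuous_on S f"
  unfolding continuous_on_def tendsto_iff
proof (intro ballI allI impI)
  fix x and e :: real assume "x \<in> S" "e > 0"
  from equicontinuous_onD[OF assms(1) this]
  show "\<forall>\<^sub>F y in at x within S. dist (f y) (f x) < e"
    by eventually_elim (use assms(2) in \<open>auto simp: dist_real_def\<close>)
qed

lemma continuous_on_borel_on:
  "continuous_on S f \<Longrightarrow> f \<in> borel_measurable (borel_on S)"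
  by (rule borel_measurable_continuous_on_restrict)

lemma space_borel_on [simp]: "space (borel_on S) = S"
  by (simp add: space_restrict_space)

lemma equicontinuous_on_measurable:
  assumes "equicontinuous_on S F" "f \<in> F" "\<mu> \<in> space (prob_algebra (borel_on S))"
  shows "f \<in> borel_measurable \<mu>"
  using continuous_on_borel_on[OF equicontinuous_on_continuous_on[OF assms(1,2)]] assms(3)
  by (simp add: space_prob_algebra cong: measurable_cong_sets)

section \<open>Weak closeness on equicontinuous families\<close>

lemma integral_abs_le_integral:
  fixes f :: "'a \<Rightarrow> real"
  assumes "integrable M f" "integrable M g" "\<And>x. x \<in> space M \<Longrightarrow> \<bar>f x\<bar> \<le> g x"
  shows "\<bar>\<integral>x. f x \<partial>M\<bar> \<le> (\<integral>x. g x \<partial>M)"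
  using integral_abs_bound[of M f] integral_mono[OF integrable_abs[OF assms(1)] assms(2) assms(3)]
  by linarith

text \<open>The \<open>\<phi> i\<close> are the increments of the running maxima of bump functions that equal 1 on half-balls
  covering \<open>S\<close> and vanish off the full balls.  So their partial sums are these maxima, and \<open>\<phi> i\<close>
  is supported where the family oscillates by less than \<open>e\<close>.\<close>

lemma equicontinuous_finite_approx:
  fixes S :: "'a::{metric_space, second_countable_topology} set" and e e' :: real
  assumes \<mu>: "\<mu> \<in> space (prob_algebra (borel_on S))"
    and F: "equicontinuous_on S F"
    and e: "e > 0" and e': "e' > 0"
  shows "\<exists>(k::nat) a \<phi>. (\<forall>i. a i \<in> S) \<and> (\<forall>i. continuous_on UNIV (\<phi> i)) \<and> (\<forall>i x. \<phi> i x \<ge> 0) \<and>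
    (\<forall>x. (\<Sum>i<k. \<phi> i x) \<le> 1) \<and> (\<integral>x. (\<Sum>i<k. \<phi> i x) \<partial>\<mu>) > 1 - e' \<and>
    (\<forall>i. \<forall>x\<in>S. \<forall>f\<in>F. \<phi> i x > 0 \<longrightarrow> \<bar>f x - f (a i)\<bar> < e)"
proof -
  have "prob_space \<mu>" and sets: "sets \<mu> = sets (borel_on S)"
    using \<mu> by (auto simp: space_prob_algebra)
  then interpret prob_space \<mu> by simp
  have space: "space \<mu> = S" using sets_eq_imp_space_eq[OF sets] by simp
  have "\<forall>x\<in>S. \<exists>r>0. \<forall>y\<in>S. dist y x < r \<longrightarrow> (\<forall>f\<in>F. \<bar>f y - f x\<bar> < e)"
  proof
    fix x assume "x \<in> S"
    then obtain d where "d > 0" "\<And>y f. y \<in> S \<Longrightarrow> dist y x < d \<Longrightarrow> f \<in> F \<Longrightarrow> \<bar>f y - f x\<bar> < e"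
      by (rule equicontinuous_on_ball[OF F _ e]) (rule that)
    then show "\<exists>r>0. \<forall>y\<in>S. dist y x < r \<longrightarrow> (\<forall>f\<in>F. \<bar>f y - f x\<bar> < e)" by blast
  qed
  from bchoice[OF this] obtain r where r: "\<And>x. x \<in> S \<Longrightarrow> r x > 0"
    "\<And>x y f. x \<in> S \<Longrightarrow> y \<in> S \<Longrightarrow> dist y x < r x \<Longrightarrow> f \<in> F \<Longrightarrow> \<bar>f y - f x\<bar> < e"
    by blast
  \<comment> \<open>A set that may fail to be compact is covered: Lindelof gives countably many
    half-balls, and the reduction to finitely many comes later from \<mu>, at the price of mass
    \<open>e'\<close>.\<close>
  obtain \<F> where \<F>: "\<F> \<subseteq> (\<lambda>x. ball x (r x / 2)) ` S" "countable \<F>"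
    "\<Union>\<F> = \<Union>((\<lambda>x. ball x (r x / 2)) ` S)"
    by (rule Lindelof[of "(\<lambda>x. ball x (r x / 2)) ` S"]) auto
  obtain D where D: "D \<subseteq> S" "countable D" "\<F> = (\<lambda>x. ball x (r x / 2)) ` D"
    using iffD1[OF countable_subset_image conjI[OF \<F>(2,1)]] by blast
  have cover: "\<exists>y\<in>D. dist x y < r y / 2" if "x \<in> S" for x
  proof -
    have "x \<in> ball x (r x / 2)" using r(1)[OF that] by simp
    then have "x \<in> \<Union>\<F>" unfolding \<F>(3) using that by blast
    then show ?thesis unfolding D(3) by (auto simp: dist_commute)
  qed
  have "D \<noteq> {}" using cover not_empty space by blast
  \<comment> \<open>The enumeration repeats points if \<open>D\<close> is finite. This is harmless,
    since a repeated bump does not raise the running maximum.\<close>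
  define a where "a = from_nat_into D"
  have aD: "a i \<in> D" for i unfolding a_def by (rule from_nat_into[OF \<open>D \<noteq> {}\<close>])
  have aS: "a i \<in> S" for i using aD D(1) by blast
  have cov: "\<exists>i. dist x (a i) < r (a i) / 2" if "x \<in> S" for x
    using cover[OF that] from_nat_into_surj[OF D(2)] unfolding a_def by metis
  define g where "g i x = max 0 (min 1 (2 - 2 * dist x (a i) / r (a i)))" for i x
  define h where "h = rec_nat (\<lambda>x. 0) (\<lambda>n hn x. max (hn x) (g n x))"
  have h0: "h 0 x = 0" and hS: "h (Suc n) x = max (h n x) (g n x)" for n x
    by (auto simp: h_def)
  define \<phi> where "\<phi> i x = h (Suc i) x - h i x" for i x
  have h_cont: "continuous_on UNIV (h n)" for n
  proof (induction n)
    case 0 then show ?case by (simp add: h_def)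
  next
    case (Suc n)
    have "continuous_on UNIV (g n)"
      unfolding g_def using r(1)[OF aS[of n]] by (intro continuous_intros) auto
    with Suc have "continuous_on UNIV (\<lambda>x. max (h n x) (g n x))"
      by (intro continuous_on_max)
    then show ?case by (simp add: hS)
  qed
  have h01: "0 \<le> h n x \<and> h n x \<le> 1" for n x
    by (induction n) (auto simp: h0 hS g_def)
  have h_mono: "m \<le> n \<Longrightarrow> h m x \<le> h n x" for m n x
    by (rule lift_Suc_mono_le[of "\<lambda>n. h n x"]) (auto simp: hS)
  have sum\<phi>: "(\<Sum>i<n. \<phi> i x) = h n x" for n x
    by (induction n) (simp_all add: h0 \<phi>_def)
  have h_meas: "h n \<in> borel_measurable \<mu>" for n
    using continuous_on_borel_on[OF continuous_on_subset[OF h_cont subset_UNIV]] sets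
    by (simp cong: measurable_cong_sets)
  have "(\<lambda>n. \<integral>x. h n x \<partial>\<mu>) \<longlonglongrightarrow> (\<integral>x. 1 \<partial>\<mu>)"
  proof (rule integral_dominated_convergence[where w="\<lambda>_. 1"])
    show "AE x in \<mu>. (\<lambda>n. h n x) \<longlonglongrightarrow> 1"
    proof (rule AE_I2)
      fix x assume "x \<in> space \<mu>"
      then obtain i where i: "dist x (a i) < r (a i) / 2" using cov space by blast
      then have "g i x = 1" using r(1)[OF aS[of i]] by (simp add: g_def field_simps)
      then have "1 \<le> h (Suc i) x" by (simp add: hS)
      then have "h n x = 1" if "n \<ge> Suc i" for n
        using h_mono[OF that, of x] h01[of n x] by linarith
      then show "(\<lambda>n. h n x) \<longlonglongrightarrow> 1"
        by (intro tendsto_eventually) (auto simp: eventually_sequentially)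
    qed
  qed (use h_meas h01 in auto)
  then have "\<forall>\<^sub>F n in sequentially. (\<integral>x. h n x \<partial>\<mu>) > 1 - e'"
    using e' by (intro order_tendstoD) (auto simp: prob_space)
  then obtain k where k: "(\<integral>x. h k x \<partial>\<mu>) > 1 - e'"
    by (auto simp: eventually_sequentially)
  show ?thesis
  proof (intro exI conjI allI ballI impI)
    show "continuous_on UNIV (\<phi> i)" for i
      unfolding \<phi>_def by (intro continuous_intros h_cont)
    show "\<phi> i x \<ge> 0" for i x by (simp add: \<phi>_def hS)
    show "(\<Sum>i<k. \<phi> i x) \<le> 1" for x using h01 by (simp add: sum\<phi>)
    show "(\<integral>x. (\<Sum>i<k. \<phi> i x) \<partial>\<mu>) > 1 - e'" using k by (simp add: sum\<phi>)
    fix i x f assume that: "x \<in> S" "f \<in> F" "\<phi> i x > 0"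
    show "\<bar>f x - f (a i)\<bar> < e"
    proof (rule r(2)[OF aS that(1) _ that(2)])
      \<comment> \<open>The running maximum grows at step i only if \<open>g i x\<close> exceeds it,
        and it is nonnegative.\<close>
      have "g i x > 0" using that(3) h01[of i x] by (auto simp: \<phi>_def hS max_def split: if_splits)
      then show "dist x (a i) < r (a i)" using r(1)[OF aS[of i]] by (simp add: g_def field_simps max_def min_def split: if_splits)
    qed
  qed (rule aS)
qed

text \<open>Finitely many test functions control a whole equicontinuous family, so no tightness argument
  is needed.\<close>

lemma integral_close_on_equicontinuous:
  fixes S :: "'a::{metric_space, second_countable_topology} set"
  assumes \<mu>: "\<mu> \<in> space (prob_algebra (borel_on S))"
    and F: "equicontinuous_on S F"
    and M: "M \<ge> 0" "\<forall>f\<in>F. \<forall>x\<in>S. \<bar>f x\<bar> \<le> M"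
    and e: "e > 0"
  shows "\<exists>(\<Phi> :: ('a \<Rightarrow> real) set) d. finite \<Phi> \<and> d > 0 \<and> (\<forall>\<phi>\<in>\<Phi>. continuous_on UNIV \<phi> \<and> (\<forall>x. \<phi> x \<in> {0..1})) \<and>
    (\<forall>\<nu>\<in>space (prob_algebra (borel_on S)).
       (\<forall>\<phi>\<in>\<Phi>. \<bar>(\<integral>x. \<phi> x \<partial>\<nu>) - (\<integral>x. \<phi> x \<partial>\<mu>)\<bar> < d) \<longrightarrow>
       (\<forall>f\<in>F. \<bar>(\<integral>x. f x \<partial>\<nu>) - (\<integral>x. f x \<partial>\<mu>)\<bar> < e))"
proof -
  \<comment> \<open>Error budget: e/8 + e/4 for replacing the integral under \<nu> by a finite sum,
    e/8 + e/8 for the same under \<mu>, and e/8 between the two sums, together less than e. Using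
    \<open>M + 1\<close> avoids a division by zero when M = 0.\<close>
  have e8: "e / 8 > 0" "e / (8 * (M + 1)) > 0" using e M(1) by auto
  from equicontinuous_finite_approx[OF \<mu> F e8]
  obtain k :: nat and a \<phi> where "\<forall>i. a i \<in> S" "\<forall>i. continuous_on UNIV (\<phi> i)"
      "\<forall>i x. \<phi> i x \<ge> 0" "\<forall>x. (\<Sum>i<k. \<phi> i x) \<le> 1"
      and ka5: "(\<integral>x. (\<Sum>i<k. \<phi> i x) \<partial>\<mu>) > 1 - e / (8 * (M + 1))"
      and "\<forall>i. \<forall>x\<in>S. \<forall>f\<in>F. \<phi> i x > 0 \<longrightarrow> \<bar>f x - f (a i)\<bar> < e / 8"
    by (elim exE conjE) (rule that)
  then have ka: "a i \<in> S" "continuous_on UNIV (\<phi> i)" "\<phi> i x \<ge> 0" "(\<Sum>i<k. \<phi> i x) \<le> 1"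
      "x \<in> S \<Longrightarrow> f \<in> F \<Longrightarrow> \<phi> i x > 0 \<Longrightarrow> \<bar>f x - f (a i)\<bar> < e / 8" for i x f
    by blast+
  have le1: "\<phi> i x \<le> 1" if "i < k" for i x
  proof -
    have "\<phi> i x \<le> (\<Sum>i<k. \<phi> i x)" using that ka(3) by (intro member_le_sum) auto
    with ka(4)[of x] show ?thesis by linarith
  qed
  \<comment> \<open>Chosen so that k weights, each off by at most d and multiplied by numbers of
    size at most M, contribute at most e/8.\<close>
  define d where "d = e / (8 * (M + 1) * (real k + 1))"
  have d: "d > 0" unfolding d_def using e M(1) by (intro divide_pos_pos mult_pos_pos) auto
  have "M * (real k * d) \<le> (M + 1) * ((real k + 1) * d)"
    using M(1) d by (intro mult_mono) auto
  also have "\<dots> = e / 8" unfolding d_def using M(1) by (simp add: divide_simps)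
  finally have Mkd: "M * (real k * d) \<le> e / 8" .
  define A where "A \<nu> i = (\<integral>x. \<phi> i x \<partial>\<nu>)" for \<nu> i
  \<comment> \<open>A Riemann sum with weights \<open>A \<nu> i\<close>: where
    \<open>\<phi> i\<close> is positive, f is within e/8 of \<open>f (a i)\<close>, and the mass
    that the bumps miss costs at most M per unit. The estimate is available for \<mu> and \<nu>
    alike.\<close>
  have est: "\<bar>(\<integral>x. f x \<partial>\<nu>) - (\<Sum>i<k. f (a i) * A \<nu> i)\<bar> \<le> e / 8 + M * (1 - (\<Sum>i<k. A \<nu> i))"
    if \<nu>: "\<nu> \<in> space (prob_algebra (borel_on S))" and f: "f \<in> F" for \<nu> f
  proof -
    have "prob_space \<nu>" and sets: "sets \<nu> = sets (borel_on S)"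
      using \<nu> by (auto simp: space_prob_algebra)
    then interpret prob_space \<nu> by simp
    have space: "space \<nu> = S" using sets_eq_imp_space_eq[OF sets] by simp
    have \<phi>_meas: "\<phi> i \<in> borel_measurable \<nu>" for i
      using continuous_on_borel_on[OF continuous_on_subset[OF ka(2) subset_UNIV]] sets
      by (simp cong: measurable_cong_sets)
    have int\<phi>: "integrable \<nu> (\<phi> i)" if "i < k" for i
      using \<phi>_meas le1[OF that] ka(3) by (intro integrable_const_bound[where B=1]) auto
    have intf: "integrable \<nu> f"
      using equicontinuous_on_measurable[OF F f \<nu>] bspec[OF M(2) f] space
      by (intro integrable_const_bound[where B=M]) auto
    have "(\<integral>x. f x \<partial>\<nu>) - (\<Sum>i<k. f (a i) * A \<nu> i) = (\<integral>x. f x - (\<Sum>i<k. f (a i) * \<phi> i x) \<partial>\<nu>)"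
      unfolding A_def using int\<phi> intf
      by (subst Bochner_Integration.integral_diff) (auto intro!: Bochner_Integration.integrable_sum)
    also have "\<bar>\<dots>\<bar> \<le> (\<integral>x. e / 8 + M * (1 - (\<Sum>i<k. \<phi> i x)) \<partial>\<nu>)"
    proof (rule integral_abs_le_integral)
      fix x assume "x \<in> space \<nu>"
      then have x: "x \<in> S" using space by simp
      have "f x - (\<Sum>i<k. f (a i) * \<phi> i x) =
          f x * (1 - (\<Sum>i<k. \<phi> i x)) + (\<Sum>i<k. \<phi> i x * (f x - f (a i)))"
        by (simp add: algebra_simps sum_subtractf sum_distrib_left)
      also have "\<bar>\<dots>\<bar> \<le> \<bar>f x * (1 - (\<Sum>i<k. \<phi> i x))\<bar> + \<bar>\<Sum>i<k. \<phi> i x * (f x - f (a i))\<bar>"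
        by (rule abs_triangle_ineq)
      also have "\<bar>f x * (1 - (\<Sum>i<k. \<phi> i x))\<bar> \<le> M * (1 - (\<Sum>i<k. \<phi> i x))"
        using M(2)[rule_format, OF f x] ka(4)[of x] by (auto simp: abs_mult intro!: mult_right_mono)
      also have "\<bar>\<Sum>i<k. \<phi> i x * (f x - f (a i))\<bar> \<le> (\<Sum>i<k. \<phi> i x * (e / 8))"
      proof (rule order_trans[OF sum_abs sum_mono])
        fix i show "\<bar>\<phi> i x * (f x - f (a i))\<bar> \<le> \<phi> i x * (e / 8)"
          using ka(3)[of i x] ka(5)[OF x f, of i]
          by (cases "\<phi> i x = 0") (auto simp: abs_mult intro!: mult_left_mono)
      qed
      also have "(\<Sum>i<k. \<phi> i x * (e / 8)) \<le> 1 * (e / 8)"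
        unfolding sum_distrib_right[symmetric] using ka(4)[of x] e by (intro mult_right_mono) auto
      finally show "\<bar>f x - (\<Sum>i<k. f (a i) * \<phi> i x)\<bar> \<le> e / 8 + M * (1 - (\<Sum>i<k. \<phi> i x))"
        by simp
    qed (use int\<phi> intf in \<open>auto intro!: Bochner_Integration.integrable_sum Bochner_Integration.integrable_diff Bochner_Integration.integrable_add\<close>)
    also have "\<dots> = e / 8 + M * (1 - (\<Sum>i<k. A \<nu> i))"
    proof -
      have "integrable \<nu> (\<lambda>x. \<Sum>i<k. \<phi> i x)"
        using int\<phi> by (intro Bochner_Integration.integrable_sum) auto
      moreover have "(\<integral>x. (\<Sum>i<k. \<phi> i x) \<partial>\<nu>) = (\<Sum>i<k. A \<nu> i)"
        using int\<phi> unfolding A_def by (intro Bochner_Integration.integral_sum) auto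
      ultimately show ?thesis by (simp add: prob_space)
    qed
    finally show ?thesis .
  qed
  have \<mu>sum: "M * (1 - (\<Sum>i<k. A \<mu> i)) \<le> e / 8"
  proof -
    have "prob_space \<mu>" and sets: "sets \<mu> = sets (borel_on S)"
      using \<mu> by (auto simp: space_prob_algebra)
    then interpret prob_space \<mu> by simp
    have \<phi>_meas: "\<phi> i \<in> borel_measurable \<mu>" for i
      using continuous_on_borel_on[OF continuous_on_subset[OF ka(2) subset_UNIV]] sets
      by (simp cong: measurable_cong_sets)
    have "integrable \<mu> (\<phi> i)" if "i < k" for i
      using \<phi>_meas le1[OF that] ka(3) by (intro integrable_const_bound[where B=1]) auto
    then have "(\<Sum>i<k. A \<mu> i) > 1 - e / (8 * (M + 1))"
      using ka5 by (simp add: A_def)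
    then have "M * (1 - (\<Sum>i<k. A \<mu> i)) \<le> M * (e / (8 * (M + 1)))"
      using M(1) by (intro mult_left_mono) auto
    also have "\<dots> \<le> e / 8" using M(1) e by (simp add: field_simps)
    finally show ?thesis .
  qed
  show ?thesis
  proof (rule exI[of _ "\<phi> ` {..<k}"], rule exI[of _ d], intro conjI ballI impI allI)
    fix \<nu> f
    assume \<nu>: "\<nu> \<in> space (prob_algebra (borel_on S))"
      and close: "\<forall>\<psi>\<in>\<phi> ` {..<k}. \<bar>(\<integral>x. \<psi> x \<partial>\<nu>) - (\<integral>x. \<psi> x \<partial>\<mu>)\<bar> < d"
      and f: "f \<in> F"
    show "\<bar>(\<integral>x. f x \<partial>\<nu>) - (\<integral>x. f x \<partial>\<mu>)\<bar> < e"
    proof -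
      have cl: "\<bar>A \<nu> i - A \<mu> i\<bar> \<le> d" if "i < k" for i
        using close that by (force simp: A_def)
      \<comment> \<open>Only \<mu> is known to put most of its mass on the bumps. The measure \<nu>
        inherits this from the closeness of the weights, so no mass can escape.\<close>
      have "(\<Sum>i<k. A \<mu> i) - (\<Sum>i<k. A \<nu> i) \<le> (\<Sum>i<k. d)"
        unfolding sum_subtractf[symmetric] using cl by (intro sum_mono) force
      then have "M * ((\<Sum>i<k. A \<mu> i) - (\<Sum>i<k. A \<nu> i)) \<le> M * (real k * d)"
        using M(1) by (intro mult_left_mono) auto
      with \<mu>sum Mkd have \<nu>sum: "M * (1 - (\<Sum>i<k. A \<nu> i)) \<le> e / 4"
        by (simp add: algebra_simps)
      have "\<bar>(\<Sum>i<k. f (a i) * A \<nu> i) - (\<Sum>i<k. f (a i) * A \<mu> i)\<bar> \<le> (\<Sum>i<k. M * d)"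
        unfolding sum_subtractf[symmetric]
      proof (rule order_trans[OF sum_abs sum_mono])
        fix i assume "i \<in> {..<k}"
        then show "\<bar>f (a i) * A \<nu> i - f (a i) * A \<mu> i\<bar> \<le> M * d"
          using cl[of i] M(2)[rule_format, OF f ka(1)] M(1)
          unfolding right_diff_distrib[symmetric] abs_mult by (intro mult_mono) auto
      qed
      also have "\<dots> \<le> e / 8" using Mkd by (simp add: algebra_simps)
      finally show ?thesis
        using est[OF \<nu> f] est[OF \<mu> f] \<mu>sum \<nu>sum e by linarith
    qed
  qed (use d ka le1 in auto)
qed

text \<open>Near (x, u) only the finitely many test functions attached to the measure
  \<open>T x u\<close> have to be controlled. Weak continuity does this for each of them, and
  finitely many neighbourhoods are intersected.\<close>

lemma equicontinuous_on_kernel_integral: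
  fixes S :: "'a::{metric_space, second_countable_topology} set" and U :: "'b::metric_space set"
  assumes T: "\<And>x u. x \<in> S \<Longrightarrow> u \<in> U \<Longrightarrow> T x u \<in> space (prob_algebra (borel_on S))"
    and wc: "weakly_continuous S U T"
    and F: "equicontinuous_on S F"
    and M: "M \<ge> 0" "\<forall>f\<in>F. \<forall>x\<in>S. \<bar>f x\<bar> \<le> M"
  shows "equicontinuous_on (S \<times> U) ((\<lambda>f (x, u). \<integral>y. f y \<partial>T x u) ` F)"
  unfolding equicontinuous_on_def
proof (intro ballI allI impI)
  fix p and e :: real assume "p \<in> S \<times> U" and e: "e > 0"
  then obtain x u where p: "p = (x, u)" and x: "x \<in> S" and u: "u \<in> U" by auto
  from integral_close_on_equicontinuous[OF T[OF x u] F M e]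
  obtain \<Phi> :: "('a \<Rightarrow> real) set" and d where \<Phi>: "finite \<Phi>" "d > 0" and
    "\<forall>\<phi>\<in>\<Phi>. continuous_on UNIV \<phi> \<and> (\<forall>x. \<phi> x \<in> {0..1})"
    "\<forall>\<nu>\<in>space (prob_algebra (borel_on S)).
       (\<forall>\<phi>\<in>\<Phi>. \<bar>(\<integral>x. \<phi> x \<partial>\<nu>) - (\<integral>x. \<phi> x \<partial>T x u)\<bar> < d) \<longrightarrow>
       (\<forall>f\<in>F. \<bar>(\<integral>x. f x \<partial>\<nu>) - (\<integral>x. f x \<partial>T x u)\<bar> < e)"
    by (elim exE conjE) (rule that)
  then have *: "\<phi> \<in> \<Phi> \<Longrightarrow> continuous_on UNIV \<phi>" "\<phi> \<in> \<Phi> \<Longrightarrow> \<phi> z \<in> {0..1}"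
    "\<nu> \<in> space (prob_algebra (borel_on S)) \<Longrightarrow>
       (\<And>\<phi>. \<phi> \<in> \<Phi> \<Longrightarrow> \<bar>(\<integral>x. \<phi> x \<partial>\<nu>) - (\<integral>x. \<phi> x \<partial>T x u)\<bar> < d) \<Longrightarrow> f \<in> F \<Longrightarrow>
       \<bar>(\<integral>x. f x \<partial>\<nu>) - (\<integral>x. f x \<partial>T x u)\<bar> < e" for \<phi> z \<nu> f
    by blast+
  have "\<forall>\<^sub>F p in at (x, u) within S \<times> U.
      \<bar>(\<integral>y. \<phi> y \<partial>T (fst p) (snd p)) - (\<integral>y. \<phi> y \<partial>T x u)\<bar> < d" if \<phi>: "\<phi> \<in> \<Phi>" for \<phi>
  proof -
    have "bounded (\<phi> ` S)"
      using *(2)[OF \<phi>] by (intro boundedI[where B=1]) auto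
    then have "continuous_on (S \<times> U) (\<lambda>(x, u). \<integral>y. \<phi> y \<partial>T x u)"
      using wc continuous_on_subset[OF *(1)[OF \<phi>] subset_UNIV] unfolding weakly_continuous_def by blast
    then have "((\<lambda>(x, u). \<integral>y. \<phi> y \<partial>T x u) \<longlongrightarrow> (\<integral>y. \<phi> y \<partial>T x u)) (at (x, u) within S \<times> U)"
      using x u unfolding continuous_on_def by fastforce
    from tendstoD[OF this \<open>d > 0\<close>] show ?thesis
      by (simp add: dist_real_def split_beta')
  qed
  then have "\<forall>\<^sub>F p in at (x, u) within S \<times> U. \<forall>\<phi>\<in>\<Phi>.
      \<bar>(\<integral>y. \<phi> y \<partial>T (fst p) (snd p)) - (\<integral>y. \<phi> y \<partial>T x u)\<bar> < d"
    using \<Phi>(1) by (intro eventually_ball_finite) auto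
  moreover have "\<forall>\<^sub>F p in at (x, u) within S \<times> U. p \<in> S \<times> U"
    by (auto simp: eventually_at_filter)
  ultimately show "\<forall>\<^sub>F q in at p within S \<times> U. \<forall>g\<in>(\<lambda>f (x, u). \<integral>y. f y \<partial>T x u) ` F. \<bar>g q - g p\<bar> < e"
    unfolding p by eventually_elim (auto intro!: *(3) T)
qed

text \<open>A tube argument. Finitely many balls of half the admissible radius cover U. For y close
  to x, both (y, u) and (x, u) then lie in the neighbourhood of a common centre (x, v), where every
  g is within e/2 of its value at the centre.\<close>

lemma equicontinuous_on_uniform_compact:
  fixes S :: "'a::metric_space set" and U :: "'b::metric_space set"
  assumes G: "equicontinuous_on (S \<times> U) G" and U: "compact U" and x: "x \<in> S" and e: "e > 0"
  shows "\<forall>\<^sub>F y in at x within S. \<forall>u\<in>U. \<forall>g\<in>G. \<bar>g (y, u) - g (x, u)\<bar> < e"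
proof -
  have "\<forall>u\<in>U. \<exists>d>0. \<forall>p\<in>S \<times> U. dist p (x, u) < d \<longrightarrow> (\<forall>g\<in>G. \<bar>g p - g (x, u)\<bar> < e / 2)"
  proof
    fix u assume "u \<in> U"
    then obtain d where "d > 0" "\<And>p g. p \<in> S \<times> U \<Longrightarrow> dist p (x, u) < d \<Longrightarrow> g \<in> G \<Longrightarrow> \<bar>g p - g (x, u)\<bar> < e / 2"
      using equicontinuous_on_ball[OF G, of "(x, u)" "e / 2"] x e by auto
    then show "\<exists>d>0. \<forall>p\<in>S \<times> U. dist p (x, u) < d \<longrightarrow> (\<forall>g\<in>G. \<bar>g p - g (x, u)\<bar> < e / 2)" by blast
  qed
  then obtain d where d: "\<And>u. u \<in> U \<Longrightarrow> d u > 0"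
    "\<And>u p g. u \<in> U \<Longrightarrow> p \<in> S \<times> U \<Longrightarrow> dist p (x, u) < d u \<Longrightarrow> g \<in> G \<Longrightarrow> \<bar>g p - g (x, u)\<bar> < e / 2"
    by metis
  have "U \<subseteq> (\<Union>u\<in>U. ball u (d u / 2))" using d(1) by force
  then obtain C where C: "C \<subseteq> U" "finite C" "U \<subseteq> (\<Union>u\<in>C. ball u (d u / 2))"
    using compactE_image[OF U, of U "\<lambda>u. ball u (d u / 2)"] by auto
  have "\<forall>\<^sub>F y in at x within S. \<forall>v\<in>C. dist y x < d v / 2"
    using C(1,2) d(1) by (intro eventually_ball_finite) (auto simp: eventually_at intro!: exI[of _ "d _ / 2"])
  moreover have "\<forall>\<^sub>F y in at x within S. y \<in> S"
    by (auto simp: eventually_at_filter)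
  ultimately show ?thesis
  proof eventually_elim
    case (elim y)
    show ?case
    proof (intro ballI)
      fix u g assume u: "u \<in> U" and g: "g \<in> G"
      then obtain v where v: "v \<in> C" "dist v u < d v / 2" using C(3) by auto
      have vU: "v \<in> U" using v(1) C(1) by auto
      \<comment> \<open>The triangle inequality in the plane, for the vectors (dist y x, 0) and (0,
        dist u v).\<close>
      have "dist (y, u) (x, v) \<le> dist y x + dist u v"
        using real_sqrt_sum_squares_triangle_ineq[of "dist y x" 0 0 "dist u v"]
        by (simp add: dist_prod_def)
      then have 1: "dist (y, u) (x, v) < d v" using v elim by (auto simp: dist_commute)
      have 2: "dist (x, u) (x, v) < d v"
        using v(2) d(1)[OF vU] zero_le_dist[of v u] unfolding dist_Pair_Pair by (simp add: dist_commute)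
      show "\<bar>g (y, u) - g (x, u)\<bar> < e"
        using d(2)[OF vU _ 1 g] d(2)[OF vU _ 2 g] u x elim(2) by (simp add: abs_less_iff) argo
    qed
  qed
qed

section \<open>Total variation\<close>

text \<open>A real supremum dominates its members only if the set is bounded above; differences of
  probabilities are at most 1.\<close>

lemma tv_dist_ge:
  assumes "prob_space \<mu>" "prob_space \<nu>" "B \<in> sets \<mu>"
  shows "\<bar>measure \<mu> B - measure \<nu> B\<bar> \<le> tv_dist \<mu> \<nu>"
proof -
  have "\<bar>measure \<mu> A - measure \<nu> A\<bar> \<le> 1" for A
    using prob_space.prob_le_1[OF assms(1), of A] prob_space.prob_le_1[OF assms(2), of A]
      measure_nonneg[of \<mu> A] measure_nonneg[of \<nu> A] by linarith
  then have "bdd_above ((\<lambda>B. \<bar>measure \<mu> B - measure \<nu> B\<bar>) ` sets \<mu>)"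
    by (intro bdd_aboveI2)
  from cSUP_upper[OF assms(3) this] have "2 * \<bar>measure \<mu> B - measure \<nu> B\<bar> \<le> tv_dist \<mu> \<nu>"
    by (simp add: tv_dist_def)
  moreover have "\<bar>measure \<mu> B - measure \<nu> B\<bar> \<le> 2 * \<bar>measure \<mu> B - measure \<nu> B\<bar>" by simp
  ultimately show ?thesis by (rule order_trans[rotated])
qed

text \<open>Counts the positive integer levels that z reaches. Applied to z = k * g x, it writes a
  quantised function as a sum of indicators of level sets.\<close>

lemma floor_le_layers:
  fixes z :: real assumes "0 \<le> z" "z \<le> real k"
  shows "(\<Sum>j=1..k. indicator {w. real j \<le> w} z) = real_of_int \<lfloor>z\<rfloor>"
proof -
  have "(\<Sum>j=1..k. indicator {w. real j \<le> w} z :: real) = real (card {j\<in>{1..k}. real j \<le> z})"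
  proof -
    have "(\<Sum>j=1..k. indicator {w. real j \<le> w} z) = (\<Sum>j\<in>{1..k}. if real j \<le> z then 1 else (0::real))"
      by (intro sum.cong) (auto simp: indicator_def)
    also have "\<dots> = (\<Sum>j\<in>{j\<in>{1..k}. real j \<le> z}. 1)"
      by (rule sum.inter_filter[symmetric]) simp
    finally show ?thesis by simp
  qed
  also have "{j\<in>{1..k}. real j \<le> z} = {1..nat \<lfloor>z\<rfloor>}"
  proof -
    have "real j \<le> z \<longleftrightarrow> j \<le> nat \<lfloor>z\<rfloor>" for j
    proof -
      have "j \<le> nat \<lfloor>z\<rfloor> \<longleftrightarrow> int j \<le> \<lfloor>z\<rfloor>" using assms by (intro le_nat_iff) simp
      also have "\<dots> \<longleftrightarrow> real j \<le> z" by (simp add: le_floor_iff)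
      finally show ?thesis by simp
    qed
    moreover have "real j \<le> z \<Longrightarrow> j \<le> k" for j using assms(2) by linarith
    ultimately show ?thesis by auto
  qed
  finally show ?thesis using assms by simp
qed

text \<open>The average of the indicators of the sets {g >= j/k}, for j = 1, ..., k, equals floor(k
  * g)/k and is uniformly within 1/k of g. Its integrals under the two measures differ by an average
  of k set differences, hence by at most \<open>tv_dist \<mu> \<nu>\<close>; then k tends to
  infinity.\<close>

lemma integral_diff_le_tv_dist_unit:
  fixes g :: "'a \<Rightarrow> real"
  assumes p: "prob_space \<mu>" "prob_space \<nu>" "sets \<mu> = sets \<nu>"
    and g: "g \<in> borel_measurable \<mu>" "\<And>x. x \<in> space \<mu> \<Longrightarrow> 0 \<le> g x \<and> g x \<le> 1"
  shows "\<bar>(\<integral>x. g x \<partial>\<mu>) - (\<integral>x. g x \<partial>\<nu>)\<bar> \<le> tv_dist \<mu> \<nu>"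
proof -
  have sp: "space \<nu> = space \<mu>" using sets_eq_imp_space_eq[OF p(3)] by simp
  have main: "\<bar>(\<integral>x. g x \<partial>\<mu>) - (\<integral>x. g x \<partial>\<nu>)\<bar> \<le> tv_dist \<mu> \<nu> + 2 / real k" if k: "k > 0" for k :: nat
  proof -
    define A where "A j = {x\<in>space \<mu>. real j \<le> real k * g x}" for j :: nat
    have A: "A j \<in> sets \<mu>" for j unfolding A_def using g(1) by measurable
    have est: "\<bar>(\<integral>x. g x \<partial>\<rho>) - (\<Sum>j=1..k. measure \<rho> (A j)) / real k\<bar> \<le> 1 / real k"
      if r: "prob_space \<rho>" "sets \<rho> = sets \<mu>" for \<rho>
    proof -
      interpret prob_space \<rho> by (rule r)
      have spr: "space \<rho> = space \<mu>" using sets_eq_imp_space_eq[OF r(2)] .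
      have Ar: "A j \<in> sets \<rho>" for j using A r(2) by simp
      have gm: "g \<in> borel_measurable \<rho>" using g(1) r(2) by (simp cong: measurable_cong_sets)
      have ig: "integrable \<rho> g"
        using gm g(2) spr by (intro integrable_const_bound[where B=1]) auto
      have iA: "integrable \<rho> (\<lambda>x. indicator (A j) x :: real)" for j
        using Ar by (intro integrable_real_indicator) (auto simp: emeasure_eq_measure)
      have "(\<integral>x. g x \<partial>\<rho>) - (\<Sum>j=1..k. measure \<rho> (A j)) / real k =
          (\<integral>x. g x - (\<Sum>j=1..k. indicator (A j) x) / real k \<partial>\<rho>)"
        using ig iA Ar by simp
      also have "\<bar>\<dots>\<bar> \<le> (\<integral>x. 1 / real k \<partial>\<rho>)"
      proof (rule integral_abs_le_integral)
        fix x assume "x \<in> space \<rho>"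
        then have x: "x \<in> space \<mu>" using spr by simp
        have gx: "0 \<le> g x" "g x \<le> 1" using g(2)[OF x] by auto
        have "(\<Sum>j=1..k. indicator (A j) x :: real) = (\<Sum>j=1..k. indicator {w. real j \<le> w} (real k * g x))"
          using x by (intro sum.cong) (auto simp: A_def indicator_def)
        also have "\<dots> = real_of_int \<lfloor>real k * g x\<rfloor>"
          using gx by (intro floor_le_layers) (auto simp: mult_left_le)
        finally have eq: "(\<Sum>j=1..k. indicator (A j) x :: real) = real_of_int \<lfloor>real k * g x\<rfloor>" .
        have "\<bar>real k * g x - real_of_int \<lfloor>real k * g x\<rfloor>\<bar> \<le> 1" by linarith
        moreover have "g x - real_of_int \<lfloor>real k * g x\<rfloor> / real k =
            (real k * g x - real_of_int \<lfloor>real k * g x\<rfloor>) / real k"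
          using k by (simp add: diff_divide_distrib)
        ultimately show "\<bar>g x - (\<Sum>j=1..k. indicator (A j) x) / real k\<bar> \<le> 1 / real k"
          unfolding eq using k by (simp add: divide_right_mono)
      qed (use ig iA in auto)
      also have "\<dots> = 1 / real k" by (simp add: prob_space)
      finally show ?thesis .
    qed
    have "\<bar>(\<Sum>j=1..k. measure \<mu> (A j)) - (\<Sum>j=1..k. measure \<nu> (A j))\<bar> \<le> (\<Sum>j=1..k. tv_dist \<mu> \<nu>)"
      unfolding sum_subtractf[symmetric]
    proof (rule order_trans[OF sum_abs sum_mono])
      fix j show "\<bar>measure \<mu> (A j) - measure \<nu> (A j)\<bar> \<le> tv_dist \<mu> \<nu>"
        by (rule tv_dist_ge[OF p(1,2) A])
    qed
    then have "\<bar>(\<Sum>j=1..k. measure \<mu> (A j)) / real k - (\<Sum>j=1..k. measure \<nu> (A j)) / real k\<bar> \<le> tv_dist \<mu> \<nu>"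
      using k by (simp add: diff_divide_distrib[symmetric] abs_divide divide_le_eq mult.commute)
    with est[OF p(1) refl] est[OF p(2) p(3)[symmetric]] show ?thesis by linarith
  qed
  have "(\<lambda>k. tv_dist \<mu> \<nu> + 2 / real k) \<longlonglongrightarrow> tv_dist \<mu> \<nu> + 0"
    by (intro tendsto_add tendsto_const lim_const_over_n)
  then show ?thesis
    using main by (intro LIMSEQ_le_const[of _ "tv_dist \<mu> \<nu>"]) (auto intro!: exI[of _ 1])
qed

lemma integral_diff_le_tv_dist:
  fixes g :: "'a \<Rightarrow> real"
  assumes p: "prob_space \<mu>" "prob_space \<nu>" "sets \<mu> = sets \<nu>" and B: "B > 0"
    and g: "g \<in> borel_measurable \<mu>" "\<And>x. x \<in> space \<mu> \<Longrightarrow> 0 \<le> g x \<and> g x \<le> B"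
  shows "\<bar>(\<integral>x. g x \<partial>\<mu>) - (\<integral>x. g x \<partial>\<nu>)\<bar> \<le> B * tv_dist \<mu> \<nu>"
proof -
  have "\<bar>(\<integral>x. g x / B \<partial>\<mu>) - (\<integral>x. g x / B \<partial>\<nu>)\<bar> \<le> tv_dist \<mu> \<nu>"
    using g B by (intro integral_diff_le_tv_dist_unit[OF p]) auto
  then show ?thesis
    using B by (simp add: diff_divide_distrib[symmetric] abs_divide divide_le_eq mult.commute)
qed

section \<open>Integrals and empirical measures\<close>

text \<open>Here x occurs both in the integrand and in the measure. Pushing \<open>L x\<close>
  forward along y \<mapsto> (x, y) moves x entirely into the measure, which leaves the integral of a
  fixed function against a measurable kernel.\<close>

lemma integral_measurable_kernel:
  fixes f :: "'a \<Rightarrow> 'b \<Rightarrow> real"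
  assumes f[measurable]: "(\<lambda>(x, y). f x y) \<in> borel_measurable (M \<Otimes>\<^sub>M N)"
    and L[measurable]: "L \<in> M \<rightarrow>\<^sub>M prob_algebra N"
  shows "(\<lambda>x. \<integral>y. f x y \<partial>L x) \<in> borel_measurable M"
proof -
  note L' [measurable] = measurable_prob_algebraD[OF L]
  note measurable_distr2[measurable]
  have "(\<lambda>x. integral\<^sup>L (distr (L x) (M \<Otimes>\<^sub>M N) (\<lambda>y. (x, y))) (\<lambda>(x, y). f x y)) \<in> borel_measurable M"
    by measurable
  then show ?thesis
    by (rule measurable_cong[THEN iffD1, rotated]) (simp add: integral_distr)
qed

lemma prob_integral_bounds:
  fixes f :: "'a \<Rightarrow> real"
  assumes "prob_space M" "f \<in> borel_measurable M" "\<And>x. x \<in> space M \<Longrightarrow> 0 \<le> f x \<and> f x \<le> B"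
  shows "integrable M f" "0 \<le> (\<integral>x. f x \<partial>M)" "(\<integral>x. f x \<partial>M) \<le> B"
proof -
  interpret prob_space M by fact
  show i: "integrable M f"
    using assms by (intro integrable_const_bound[where B=B]) auto
  show "0 \<le> (\<integral>x. f x \<partial>M)" using assms(3) by (intro Bochner_Integration.integral_nonneg) auto
  show "(\<integral>x. f x \<partial>M) \<le> B" using assms(3) by (intro integral_le_const[OF i]) auto
qed

text \<open>By second countability the Borel sets of the product are generated by rectangles, so the
  identity map is measurable from the product of the two relative sigma-algebras into the relative
  one on \<open>A \<times> B\<close>.\<close>

lemma continuous_on_Times_measurable:
  fixes f :: "'a::second_countable_topology \<times> 'b::second_countable_topology \<Rightarrow> real"
  assumes "continuous_on (A \<times> B) f"
  shows "f \<in> borel_measurable (borel_on A \<Otimes>\<^sub>M borel_on B)"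
proof (rule measurable_compose[OF _ continuous_on_borel_on[OF assms]])
  have 1: "fst \<in> borel_on A \<Otimes>\<^sub>M borel_on B \<rightarrow>\<^sub>M borel" "snd \<in> borel_on A \<Otimes>\<^sub>M borel_on B \<rightarrow>\<^sub>M borel"
    using measurable_compose[OF measurable_fst measurable_restrict_space1[OF measurable_ident]]
      measurable_compose[OF measurable_snd measurable_restrict_space1[OF measurable_ident]]
    by (simp_all add: comp_def id_def)
  have "(\<lambda>p. (fst p, snd p)) \<in> borel_on A \<Otimes>\<^sub>M borel_on B \<rightarrow>\<^sub>M borel"
    unfolding borel_prod[symmetric] by (rule measurable_Pair[OF 1])
  then show "(\<lambda>x. x) \<in> borel_on A \<Otimes>\<^sub>M borel_on B \<rightarrow>\<^sub>M borel_on (A \<times> B)"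
    by (intro measurable_restrict_space2) (auto simp: space_pair_measure)
qed

text \<open>Deviations of size e have probability at most 2 * q^n with q = exp(-2 e^2) < 1, which is
  summable for each fixed e. The null sets are collected only over the tolerances 1/(k+1).\<close>

lemma (in prob_space) strong_law_bounded:
  fixes \<phi> :: "'b \<Rightarrow> real"
  assumes indep: "indep_vars (\<lambda>_. N) \<xi> {1..}"
    and law: "\<And>i::nat. i \<ge> 1 \<Longrightarrow> distr M N (\<xi> i) = P"
    and \<phi>: "\<phi> \<in> borel_measurable N" "\<And>x. \<phi> x \<in> {0..1}"
  shows "AE \<omega> in M. (\<lambda>n. (\<Sum>i=1..n. \<phi> (\<xi> i \<omega>)) / real n) \<longlonglongrightarrow> (\<integral>x. \<phi> x \<partial>P)"
proof -
  have \<xi>: "\<xi> i \<in> M \<rightarrow>\<^sub>M N" if "i \<ge> 1" for i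
    using indep that unfolding indep_vars_def by auto
  have \<phi>\<xi>: "(\<lambda>\<omega>. \<phi> (\<xi> i \<omega>)) \<in> borel_measurable M" if "i \<ge> 1" for i
    by (rule measurable_compose[OF \<xi>[OF that] \<phi>(1)])
  let ?avg = "\<lambda>n \<omega>. (\<Sum>i=1..n. \<phi> (\<xi> i \<omega>)) / real n" and ?m = "\<integral>x. \<phi> x \<partial>P"
  have avg: "?avg n \<in> borel_measurable M" for n
    by (intro borel_measurable_divide borel_measurable_sum \<phi>\<xi>) auto
  have ev: "AE \<omega> in M. \<forall>\<^sub>F n in sequentially. \<bar>?avg n \<omega> - ?m\<bar> < e" if e: "e > 0" for e :: real
  proof -
    define A where "A n = {\<omega>\<in>space M. \<bar>?avg n \<omega> - ?m\<bar> \<ge> e}" for n :: nat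
    have A: "A n \<in> events" for n
      unfolding A_def using avg[of n] by measurable
    have pA: "prob (A n) \<le> 2 * exp (- 2 * e\<^sup>2) ^ n" for n
    proof (cases "n = 0")
      case True
      have "prob (A n) \<le> 2" using prob_le_1[of "A n"] by linarith
      with True show ?thesis by simp
    next
      case False
      have m: "?m = expectation (\<lambda>\<omega>. \<phi> (\<xi> 1 \<omega>))"
        using integral_distr[OF \<xi>[of 1] \<phi>(1)] law[of 1] by simp
      have dist: "distr M borel (\<lambda>\<omega>. \<phi> (\<xi> i \<omega>)) = distr P borel \<phi>" if "i \<ge> 1" for i
        using distr_distr[OF \<phi>(1) \<xi>[OF that]] law[OF that] by (simp add: comp_def)
      interpret H: Hoeffding_ineq_iid M "{1..n}" "\<lambda>i \<omega>. \<phi> (\<xi> i \<omega>)" "\<lambda>\<omega>. \<phi> (\<xi> 1 \<omega>)" 0 1 ?m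
      proof unfold_locales
        show "indep_vars (\<lambda>_. borel) (\<lambda>i \<omega>. \<phi> (\<xi> i \<omega>)) {1..n}"
          by (rule indep_vars_compose2[OF indep_vars_subset[OF indep] \<phi>(1)]) auto
        show "?m \<equiv> expectation (\<lambda>\<omega>. \<phi> (\<xi> 1 \<omega>))" by (rule eq_reflection[OF m])
      qed (use dist \<phi>(2) \<phi>\<xi> in auto)
      have "prob (A n) \<le> 2 * exp (- 2 * real n * e\<^sup>2)"
        using H.Hoeffding_ineq_abs_ge'[of e] e False by (simp add: A_def)
      also have "exp (- 2 * real n * e\<^sup>2) = exp (- 2 * e\<^sup>2) ^ n"
        by (simp add: exp_of_nat_mult[symmetric] ac_simps)
      finally show ?thesis .
    qed
    have "summable (\<lambda>n. 2 * exp (- 2 * e\<^sup>2) ^ n)"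
      using e by (intro summable_mult summable_geometric) simp
    then have "summable (\<lambda>n. prob (A n))"
      by (rule summable_comparison_test'[where N=0]) (use pA in simp)
    then have "AE \<omega> in M. \<forall>\<^sub>F n in sequentially. \<omega> \<in> space M - A n"
      using A by (intro borel_cantelli_AE1) (auto simp: emeasure_eq_measure)
    then show ?thesis
    proof eventually_elim
      case (elim \<omega>)
      then show ?case by eventually_elim (auto simp: A_def)
    qed
  qed
  have "AE \<omega> in M. \<forall>k::nat. \<forall>\<^sub>F n in sequentially. \<bar>?avg n \<omega> - ?m\<bar> < 1 / real (Suc k)"
    unfolding AE_all_countable by (intro allI ev) simp
  then show ?thesis
  proof eventually_elim
    case (elim \<omega>)
    show ?case
    proof (rule tendstoI)
      fix e :: real assume "e > 0"
      then obtain k where k: "1 / real (Suc k) < e" using nat_approx_posE by blast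
      from elim[rule_format, of k] show "\<forall>\<^sub>F n in sequentially. dist (?avg n \<omega>) ?m < e"
        by eventually_elim (use k in \<open>auto simp: dist_real_def\<close>)
    qed
  qed
qed

text \<open>The empirical measure is the image under \<open>xs\<close> of the uniform measure on
  {1..n}, so the change of variables formula yields a finite average.\<close>

lemma integral_empirical_measure:
  fixes \<phi> :: "'a::topological_space \<Rightarrow> real"
  assumes n: "n \<ge> 1" and xs: "\<And>i. i \<in> {1..n} \<Longrightarrow> xs i \<in> X"
    and \<phi>: "\<phi> \<in> borel_measurable (borel_on X)"
  shows "(\<integral>x. \<phi> x \<partial>empirical_measure X n xs) = (\<Sum>i=1..n. \<phi> (xs i)) / real n"
proof -
  let ?U = "uniform_count_measure {1..n}"
  have m: "xs \<in> ?U \<rightarrow>\<^sub>M borel_on X"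
    using xs by (auto simp: measurable_def sets_uniform_count_measure space_uniform_count_measure)
  have sets: "sets (empirical_measure X n xs) = sets (borel_on X)"
    using empirical_measure_in_prob_algebra[of n xs X, OF n xs] by (simp add: space_prob_algebra)
  have "empirical_measure X n xs = distr ?U (borel_on X) xs"
  proof (rule measure_eqI)
    fix B assume "B \<in> sets (empirical_measure X n xs)"
    then have B: "B \<in> sets (borel_on X)" using sets by simp
    have "(\<Sum>i=1..n. indicator B (xs i)) = (\<Sum>i\<in>{1..n}. if xs i \<in> B then 1 else (0::real))"
      by (intro sum.cong) (auto simp: indicator_def)
    also have "\<dots> = (\<Sum>i\<in>{i\<in>{1..n}. xs i \<in> B}. 1)"
      by (rule sum.inter_filter[symmetric]) simp
    also have "{i\<in>{1..n}. xs i \<in> B} = xs -` B \<inter> {1..n}" by auto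
    finally have eq: "(\<Sum>i=1..n. indicator B (xs i)) = real (card (xs -` B \<inter> {1..n}))" by simp
    show "emeasure (empirical_measure X n xs) B = emeasure (distr ?U (borel_on X) xs) B"
      unfolding emeasure_empirical_measure[OF B] emeasure_distr[OF m B] eq
      using n by (subst emeasure_uniform_count_measure)
        (auto simp: space_uniform_count_measure divide_ennreal[symmetric] ennreal_of_nat_eq_real_of_nat)
  qed (simp add: sets)
  then show ?thesis
    using integral_distr[OF m \<phi>] by (simp add: integral_uniform_count_measure)
qed

section \<open>Cost-to-go functions\<close>

text \<open>Both components stop before time t, whereas a policy at time t also receives the current
  observation: the cost-to-go is conditioned on the past before that observation is made, and
  integrates over it.\<close>

abbreviation info_space ::
    "'y::topological_space set \<Rightarrow> 'u::topological_space set \<Rightarrow> nat \<Rightarrow> ((nat \<Rightarrow> 'y) \<times> (nat \<Rightarrow> 'u)) measure" where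
  "info_space Y U t \<equiv> PiM {..<t} (\<lambda>_. borel_on Y) \<Otimes>\<^sub>M PiM {..<t} (\<lambda>_. borel_on U)"

text \<open>Fixes the data of the model and leaves the prior and the policy free, since the
  estimates have to be uniform in the policy and compare two priors.\<close>

locale pomdp =
  fixes X :: "'x::{metric_space, second_countable_topology} set"
    and Y :: "'y::topological_space set"
    and U :: "'u::{metric_space, second_countable_topology} set"
    and Q :: "'x \<Rightarrow> 'y measure"
    and T :: "'x \<Rightarrow> 'u \<Rightarrow> 'x measure"
    and c :: "'x \<Rightarrow> 'u \<Rightarrow> real"
    and \<beta> C :: real
  assumes Q: "Q \<in> borel_on X \<rightarrow>\<^sub>M prob_algebra (borel_on Y)"
    and T: "(\<lambda>(x, u). T x u) \<in> borel_on X \<Otimes>\<^sub>M borel_on U \<rightarrow>\<^sub>M prob_algebra (borel_on X)"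
    and \<beta>: "0 < \<beta>" "\<beta> < 1"
    and weak: "weakly_continuous X U T"
    and tv: "tv_continuous X Q"
    and c: "\<And>x u. x \<in> X \<Longrightarrow> u \<in> U \<Longrightarrow> 0 \<le> c x u \<and> c x u \<le> C"
    and c_cont: "continuous_on (X \<times> U) (\<lambda>(x, u). c x u)"
    and U: "compact U"
    and C: "C > 0"
begin

text \<open>The integrand of the recursion, kept as a function of x and y so that a change of x
  inside it can be separated from the change of the measure \<open>Q x\<close>. The action
  \<open>u\<close> is determined by y and the past alone.\<close>

definition stage_value ::
    "(nat \<Rightarrow> (nat \<Rightarrow> 'y) \<Rightarrow> (nat \<Rightarrow> 'u) \<Rightarrow> 'x \<Rightarrow> real) \<Rightarrow> ('y, 'u) policy \<Rightarrow>
     nat \<Rightarrow> (nat \<Rightarrow> 'y) \<Rightarrow> (nat \<Rightarrow> 'u) \<Rightarrow> 'x \<Rightarrow> 'y \<Rightarrow> real" where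
  "stage_value f \<gamma> t ys us x y =
     (let u = \<gamma> t (ys(t := y)) us
      in c x u + \<beta> * (\<integral>x'. f (Suc t) (ys(t := y)) (us(t := u)) x' \<partial>T x u))"

text \<open>\<open>cost_to_go \<gamma> N t ys us x\<close> is the expected discounted cost of the stages \<open>t, \<dots>, t + N - 1\<close>,
  discounted from time \<open>t\<close>, given \<open>X\<^sub>t = x\<close>, the observations \<open>ys\<close> and the actions \<open>us\<close> before time \<open>t\<close>.\<close>

primrec cost_to_go ::
    "('y, 'u) policy \<Rightarrow> nat \<Rightarrow> nat \<Rightarrow> (nat \<Rightarrow> 'y) \<Rightarrow> (nat \<Rightarrow> 'u) \<Rightarrow> 'x \<Rightarrow> real" where
  "cost_to_go \<gamma> 0 = (\<lambda>t ys us x. 0)"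
| "cost_to_go \<gamma> (Suc N) = (\<lambda>t ys us x. \<integral>y. stage_value (cost_to_go \<gamma> N) \<gamma> t ys us x y \<partial>Q x)"

text \<open>The value of the geometric series with all stage costs equal to C, and the fixed point
  of r = C + \<beta> * r. A bound K on the continuation therefore reproduces itself over one stage,
  independently of the horizon.\<close>

definition K :: real where "K = C / (1 - \<beta>)"

lemma K: "K > 0" "C + \<beta> * K = K"
  using C \<beta> by (auto simp: K_def field_simps)

lemma Q_space: "x \<in> X \<Longrightarrow> Q x \<in> space (prob_algebra (borel_on Y))"
  using measurable_space[OF Q] by simp

lemma T_space: "x \<in> X \<Longrightarrow> u \<in> U \<Longrightarrow> T x u \<in> space (prob_algebra (borel_on X))"
  using measurable_space[OF T, of "(x, u)"] by (simp add: space_pair_measure)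

lemma c_measurable: "(\<lambda>(x, u). c x u) \<in> borel_measurable (borel_on X \<Otimes>\<^sub>M borel_on U)"
  by (rule continuous_on_Times_measurable[OF c_cont])

lemma policy_measurable:
  assumes "\<gamma> \<in> admissible_policies Y U"
  shows "(\<lambda>(ys, us). \<gamma> t ys us) \<in>
    PiM {..t} (\<lambda>_. borel_on Y) \<Otimes>\<^sub>M PiM {..<t} (\<lambda>_. borel_on U) \<rightarrow>\<^sub>M borel_on U"
  using assms by (auto simp: admissible_policies_def)

section \<open>Measurability and bounds of the cost-to-go functions\<close>

lemma fun_upd_measurable:
  fixes t :: nat
  assumes "f \<in> M \<rightarrow>\<^sub>M PiM {..<t} (\<lambda>_. L)" "g \<in> M \<rightarrow>\<^sub>M L"
  shows "(\<lambda>w. (f w)(t := g w)) \<in> M \<rightarrow>\<^sub>M PiM {..t} (\<lambda>_. L)"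
  by (rule measurable_fun_upd[OF _ assms]) auto

text \<open>Information and observation are measurable functions on an arbitrary space, so that the
  lemma serves both with a varying history and with a frozen one.\<close>

lemma control_measurable:
  assumes \<gamma>: "\<gamma> \<in> admissible_policies Y U"
    and f: "f \<in> M \<rightarrow>\<^sub>M info_space Y U t" and g: "g \<in> M \<rightarrow>\<^sub>M borel_on Y"
  shows "(\<lambda>w. \<gamma> t ((fst (f w))(t := g w)) (snd (f w))) \<in> M \<rightarrow>\<^sub>M borel_on U"
proof -
  have "(\<lambda>w. ((fst (f w))(t := g w), snd (f w))) \<in>
      M \<rightarrow>\<^sub>M PiM {..t} (\<lambda>_. borel_on Y) \<Otimes>\<^sub>M PiM {..<t} (\<lambda>_. borel_on U)"
    using g measurable_compose[OF f measurable_fst] measurable_compose[OF f measurable_snd]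
    by (intro measurable_Pair fun_upd_measurable)
  from measurable_compose[OF this policy_measurable[OF \<gamma>]] show ?thesis by simp
qed

lemma info_update_measurable:
  assumes \<gamma>: "\<gamma> \<in> admissible_policies Y U"
    and f: "f \<in> M \<rightarrow>\<^sub>M info_space Y U t" and g: "g \<in> M \<rightarrow>\<^sub>M borel_on Y"
  shows "(\<lambda>w. ((fst (f w))(t := g w), (snd (f w))(t := \<gamma> t ((fst (f w))(t := g w)) (snd (f w))))) \<in>
    M \<rightarrow>\<^sub>M info_space Y U (Suc t)"
  unfolding lessThan_Suc_atMost
  using g measurable_compose[OF f measurable_fst] measurable_compose[OF f measurable_snd]
    control_measurable[OF assms]
  by (intro measurable_Pair fun_upd_measurable)

lemma info_update_space:
  assumes \<gamma>: "\<gamma> \<in> admissible_policies Y U"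
    and h: "(ys, us) \<in> space (info_space Y U t)" and y: "y \<in> Y"
  shows "\<gamma> t (ys(t := y)) us \<in> U"
    "(ys(t := y), us(t := \<gamma> t (ys(t := y)) us)) \<in> space (info_space Y U (Suc t))"
proof -
  have 1: "fst \<in> info_space Y U t \<Otimes>\<^sub>M borel_on Y \<rightarrow>\<^sub>M info_space Y U t"
    and 2: "snd \<in> info_space Y U t \<Otimes>\<^sub>M borel_on Y \<rightarrow>\<^sub>M borel_on Y" by simp_all
  have 3: "((ys, us), y) \<in> space (info_space Y U t \<Otimes>\<^sub>M borel_on Y)"
    using h y by (simp add: space_pair_measure)
  show "\<gamma> t (ys(t := y)) us \<in> U"
    using measurable_space[OF control_measurable[OF \<gamma> 1 2] 3] by simp
  show "(ys(t := y), us(t := \<gamma> t (ys(t := y)) us)) \<in> space (info_space Y U (Suc t))"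
    using measurable_space[OF info_update_measurable[OF \<gamma> 1 2] 3] by simp
qed

lemma stage_value_measurable:
  assumes \<gamma>: "\<gamma> \<in> admissible_policies Y U"
    and f: "(\<lambda>((ys, us), x). f (Suc t) ys us x) \<in> borel_measurable (info_space Y U (Suc t) \<Otimes>\<^sub>M borel_on X)"
  shows "(\<lambda>(((ys, us), x), y). stage_value f \<gamma> t ys us x y) \<in>
    borel_measurable ((info_space Y U t \<Otimes>\<^sub>M borel_on X) \<Otimes>\<^sub>M borel_on Y)"
proof -
  let ?M = "(info_space Y U t \<Otimes>\<^sub>M borel_on X) \<Otimes>\<^sub>M borel_on Y"
  let ?u = "\<lambda>w. \<gamma> t ((fst (fst (fst w)))(t := snd w)) (snd (fst (fst w)))"
  have 1: "(\<lambda>w. fst (fst w)) \<in> ?M \<rightarrow>\<^sub>M info_space Y U t"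
    and 2: "snd \<in> ?M \<rightarrow>\<^sub>M borel_on Y"
    and 3: "(\<lambda>w. snd (fst w)) \<in> ?M \<rightarrow>\<^sub>M borel_on X" by measurable
  note u = control_measurable[OF \<gamma> 1 2]
  have xu: "(\<lambda>w. (snd (fst w), ?u w)) \<in> ?M \<rightarrow>\<^sub>M borel_on X \<Otimes>\<^sub>M borel_on U"
    using 3 u by (rule measurable_Pair)
  have cm: "(\<lambda>w. c (snd (fst w)) (?u w)) \<in> borel_measurable ?M"
    using measurable_compose[OF xu c_measurable] by simp
  have Tm: "(\<lambda>w. T (snd (fst w)) (?u w)) \<in> ?M \<rightarrow>\<^sub>M prob_algebra (borel_on X)"
    using measurable_compose[OF xu T] by simp
  have "(\<lambda>v. (((fst (fst (fst (fst v))))(t := snd (fst v)),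
        (snd (fst (fst (fst v))))(t := ?u (fst v))), snd v)) \<in>
      ?M \<Otimes>\<^sub>M borel_on X \<rightarrow>\<^sub>M info_space Y U (Suc t) \<Otimes>\<^sub>M borel_on X"
    by (rule measurable_Pair[OF measurable_compose[OF measurable_fst info_update_measurable[OF \<gamma> 1 2]] measurable_snd])
  from measurable_compose[OF this f]
  have "(\<lambda>(w, x'). f (Suc t) ((fst (fst (fst w)))(t := snd w)) ((snd (fst (fst w)))(t := ?u w)) x') \<in>
      borel_measurable (?M \<Otimes>\<^sub>M borel_on X)"
    by (simp add: split_beta')
  from integral_measurable_kernel[OF this Tm] cm show ?thesis
    unfolding stage_value_def Let_def split_beta' by (intro borel_measurable_add borel_measurable_times) auto
qed

text \<open>Measurability has to be joint in the history and the state, because the history passed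
  on by the recursion varies with the integration variable y.\<close>

lemma cost_to_go_measurable:
  assumes \<gamma>: "\<gamma> \<in> admissible_policies Y U"
  shows "(\<lambda>((ys, us), x). cost_to_go \<gamma> N t ys us x) \<in> borel_measurable (info_space Y U t \<Otimes>\<^sub>M borel_on X)"
proof (induction N arbitrary: t)
  case (Suc N)
  have 1: "(\<lambda>w. Q (snd w)) \<in> info_space Y U t \<Otimes>\<^sub>M borel_on X \<rightarrow>\<^sub>M prob_algebra (borel_on Y)"
    by (rule measurable_compose[OF measurable_snd Q])
  have "(\<lambda>(w, y). stage_value (cost_to_go \<gamma> N) \<gamma> t (fst (fst w)) (snd (fst w)) (snd w) y) \<in>
      borel_measurable ((info_space Y U t \<Otimes>\<^sub>M borel_on X) \<Otimes>\<^sub>M borel_on Y)"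
    using stage_value_measurable[where f="cost_to_go \<gamma> N", OF \<gamma> Suc.IH] by (simp add: split_beta')
  from integral_measurable_kernel[OF this 1] show ?case
    by (simp add: split_beta')
qed (simp add: split_beta')

lemma cost_to_go_measurable1:
  assumes "\<gamma> \<in> admissible_policies Y U" "(ys, us) \<in> space (info_space Y U t)"
  shows "cost_to_go \<gamma> N t ys us \<in> borel_measurable (borel_on X)"
  using measurable_compose[OF measurable_Pair1'[OF assms(2)] cost_to_go_measurable[OF assms(1)]] by simp

lemma stage_value_measurable1:
  assumes \<gamma>: "\<gamma> \<in> admissible_policies Y U" and h: "(ys, us) \<in> space (info_space Y U t)" and x: "x \<in> X"
  shows "stage_value (cost_to_go \<gamma> N) \<gamma> t ys us x \<in> borel_measurable (borel_on Y)"
proof -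
  have "((ys, us), x) \<in> space (info_space Y U t \<Otimes>\<^sub>M borel_on X)"
    using h x by (simp add: space_pair_measure)
  from measurable_compose[OF measurable_Pair1'[OF this] 
      stage_value_measurable[where f="cost_to_go \<gamma> N", OF \<gamma> cost_to_go_measurable[OF \<gamma>]]]
  show ?thesis by simp
qed

text \<open>The bounds for N stages appear as the premise \<open>W\<close> because this is the
  induction step for \<open>cost_to_go_bounds\<close>.\<close>

lemma stage_value_bounds:
  assumes \<gamma>: "\<gamma> \<in> admissible_policies Y U" and h: "(ys, us) \<in> space (info_space Y U t)"
    and x: "x \<in> X" and y: "y \<in> Y"
    and W: "\<And>t ys us x. (ys, us) \<in> space (info_space Y U t) \<Longrightarrow> x \<in> X \<Longrightarrow>
      0 \<le> cost_to_go \<gamma> N t ys us x \<and> cost_to_go \<gamma> N t ys us x \<le> K"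
  shows "0 \<le> stage_value (cost_to_go \<gamma> N) \<gamma> t ys us x y \<and> stage_value (cost_to_go \<gamma> N) \<gamma> t ys us x y \<le> K"
proof -
  let ?u = "\<gamma> t (ys(t := y)) us"
  note i = info_update_space[OF \<gamma> h y]
  have p: "prob_space (T x ?u)" and sets: "sets (T x ?u) = sets (borel_on X)"
    using T_space[OF x i(1)] by (auto simp: space_prob_algebra)
  have sp: "space (T x ?u) = X" using sets_eq_imp_space_eq[OF sets] by simp
  have m: "cost_to_go \<gamma> N (Suc t) (ys(t := y)) (us(t := ?u)) \<in> borel_measurable (T x ?u)"
    using cost_to_go_measurable1[OF \<gamma> i(2)] sets by (simp cong: measurable_cong_sets)
  note b = prob_integral_bounds(2,3)[OF p m, unfolded sp, OF W[OF i(2)]]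
  have "0 \<le> c x ?u + \<beta> * (\<integral>x'. cost_to_go \<gamma> N (Suc t) (ys(t := y)) (us(t := ?u)) x' \<partial>T x ?u)"
    using c[OF x i(1)] b(1) \<beta> by simp
  moreover have "\<dots> \<le> C + \<beta> * K"
    using c[OF x i(1)] b(2) \<beta> by (intro add_mono mult_left_mono) auto
  ultimately show ?thesis unfolding stage_value_def Let_def K(2) by simp
qed

lemma cost_to_go_bounds:
  assumes \<gamma>: "\<gamma> \<in> admissible_policies Y U" and "(ys, us) \<in> space (info_space Y U t)" "x \<in> X"
  shows "0 \<le> cost_to_go \<gamma> N t ys us x \<and> cost_to_go \<gamma> N t ys us x \<le> K"
  using assms(2,3)
proof (induction N arbitrary: t ys us x)
  case 0 then show ?case using K(1) by simp
next
  case (Suc N)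
  have p: "prob_space (Q x)" and sets: "sets (Q x) = sets (borel_on Y)"
    using Q_space[OF Suc.prems(2)] by (auto simp: space_prob_algebra)
  have sp: "space (Q x) = Y" using sets_eq_imp_space_eq[OF sets] by simp
  have m: "stage_value (cost_to_go \<gamma> N) \<gamma> t ys us x \<in> borel_measurable (Q x)"
    using stage_value_measurable1[OF \<gamma> Suc.prems] sets by (simp cong: measurable_cong_sets)
  show ?case
    using prob_integral_bounds(2,3)[OF p m, unfolded sp, OF stage_value_bounds[OF \<gamma> Suc.prems _ Suc.IH]]
    by simp
qed

definition cost_family :: "nat \<Rightarrow> ('x \<Rightarrow> real) set" where
  "cost_family N = {cost_to_go \<gamma> N t ys us | \<gamma> t ys us.
     \<gamma> \<in> admissible_policies Y U \<and> (ys, us) \<in> space (info_space Y U t)}"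

lemma cost_family_bounded: "\<forall>f\<in>cost_family N. \<forall>x\<in>X. \<bar>f x\<bar> \<le> K"
  using cost_to_go_bounds by (fastforce simp: cost_family_def)

lemma tv_eventually:
  assumes x: "x \<in> X" and e: "e > 0"
  shows "\<forall>\<^sub>F x' in at x within X. tv_dist (Q x') (Q x) < e"
proof (rule sequentially_imp_eventually_within, intro allI impI)
  fix f assume f: "(\<forall>n. f n \<in> X \<and> f n \<noteq> x) \<and> f \<longlonglongrightarrow> x"
  then have "(\<lambda>n. tv_dist (Q (f n)) (Q x)) \<longlonglongrightarrow> 0"
    using tv x unfolding tv_continuous_def by blast
  then show "\<forall>\<^sub>F n in sequentially. tv_dist (Q (f n)) (Q x) < e"
    using e by (rule order_tendstoD)
qed

text \<open>With g the stage value, the intermediate term is the integral of \<open>g x\<close>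
  under \<open>Q x'\<close>. Passing to it from \<open>g x'\<close> compares integrands at the same
  y, hence with the same action, so joint continuity in (x, u), uniform over U, applies. Passing
  from it to the integral under \<open>Q x\<close> keeps the integrand fixed, measurable in y and
  bounded by K, so total variation applies.\<close>

lemma equicontinuous_cost_family: "equicontinuous_on X (cost_family N)"
proof (induction N)
  case 0
  have "cost_family 0 \<subseteq> {\<lambda>x. 0}" by (auto simp: cost_family_def)
  then show ?case unfolding equicontinuous_on_def by (auto intro!: always_eventually)
next
  case (Suc N)
  let ?G = "(\<lambda>f (x, u). \<integral>y. f y \<partial>T x u) ` cost_family N"
  have G: "equicontinuous_on (X \<times> U) ?G"
    by (rule equicontinuous_on_kernel_integral[OF T_space weak Suc.IH less_imp_le[OF K(1)] cost_family_bounded])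
  have cG: "equicontinuous_on (X \<times> U) {\<lambda>(x, u). c x u}"
    unfolding equicontinuous_on_def
  proof (intro ballI allI impI)
    fix p and e :: real assume "p \<in> X \<times> U" "e > 0"
    then have "\<forall>\<^sub>F q in at p within X \<times> U. dist ((\<lambda>(x, u). c x u) q) ((\<lambda>(x, u). c x u) p) < e"
      using c_cont unfolding continuous_on_def by (intro tendstoD) auto
    then show "\<forall>\<^sub>F q in at p within X \<times> U. \<forall>f\<in>{\<lambda>(x, u). c x u}. \<bar>f q - f p\<bar> < e"
      by (simp add: dist_real_def)
  qed
  show ?case
    unfolding equicontinuous_on_def
  proof (intro ballI allI impI)
    fix x and e :: real assume x: "x \<in> X" and e: "e > 0"
    \<comment> \<open>One quarter each for the stage cost and the continuation; the third bound
      turns K * tv_dist into another quarter, leaving a strict margin.\<close>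
    have e4: "e / 4 > 0" "e / (4 * K) > 0" using e K(1) by auto
    have "\<forall>\<^sub>F y in at x within X. y \<in> X" by (auto simp: eventually_at_filter)
    with equicontinuous_on_uniform_compact[OF G U x e4(1)]
      equicontinuous_on_uniform_compact[OF cG U x e4(1)] tv_eventually[OF x e4(2)]
    show "\<forall>\<^sub>F x' in at x within X. \<forall>f\<in>cost_family (Suc N). \<bar>f x' - f x\<bar> < e"
    proof eventually_elim
      case (elim x')
      note x' = \<open>x' \<in> X\<close>
      show ?case
      proof
        fix f assume "f \<in> cost_family (Suc N)"
        then obtain \<gamma> t ys us where f: "f = cost_to_go \<gamma> (Suc N) t ys us"
          and \<gamma>: "\<gamma> \<in> admissible_policies Y U" and h: "(ys, us) \<in> space (info_space Y U t)"
          by (auto simp: cost_family_def)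
        define g where "g = stage_value (cost_to_go \<gamma> N) \<gamma> t ys us"
        have Qx: "prob_space (Q x)" "sets (Q x) = sets (borel_on Y)"
          and Qx': "prob_space (Q x')" "sets (Q x') = sets (borel_on Y)"
          using Q_space[OF x] Q_space[OF x'] by (auto simp: space_prob_algebra)
        have sp: "space (Q x') = Y" using sets_eq_imp_space_eq[OF Qx'(2)] by simp
        have gm: "g z \<in> borel_measurable (Q x')" if "z \<in> X" for z
          using stage_value_measurable1[OF \<gamma> h that] Qx'(2) unfolding g_def by (simp cong: measurable_cong_sets)
        have gb: "0 \<le> g z y \<and> g z y \<le> K" if "z \<in> X" "y \<in> Y" for z y
          unfolding g_def by (rule stage_value_bounds[OF \<gamma> h that cost_to_go_bounds[OF \<gamma>]])
        have gi: "integrable (Q x') (g z)" if "z \<in> X" for z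
          using prob_integral_bounds(1)[OF Qx'(1) gm[OF that]] gb[OF that] sp by blast
        have gd: "\<bar>g x' y - g x y\<bar> \<le> e / 4 + e / 4" if y: "y \<in> Y" for y
        proof -
          let ?u = "\<gamma> t (ys(t := y)) us"
          note i = info_update_space[OF \<gamma> h y]
          let ?f = "cost_to_go \<gamma> N (Suc t) (ys(t := y)) (us(t := ?u))"
          have "?f \<in> cost_family N" using \<gamma> i(2) by (auto simp: cost_family_def)
          then have 1: "\<bar>(\<integral>y. ?f y \<partial>T x' ?u) - (\<integral>y. ?f y \<partial>T x ?u)\<bar> < e / 4"
            using bspec[OF bspec[OF elim(1) i(1)] imageI] by fastforce
          have 2: "\<bar>c x' ?u - c x ?u\<bar> < e / 4" using elim(2) i(1) by auto
          have "\<bar>g x' y - g x y\<bar> = \<bar>(c x' ?u - c x ?u) + \<beta> * ((\<integral>y. ?f y \<partial>T x' ?u) - (\<integral>y. ?f y \<partial>T x ?u))\<bar>"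
            by (simp add: g_def stage_value_def Let_def algebra_simps)
          also have "\<dots> \<le> \<bar>c x' ?u - c x ?u\<bar> + \<beta> * \<bar>(\<integral>y. ?f y \<partial>T x' ?u) - (\<integral>y. ?f y \<partial>T x ?u)\<bar>"
            using \<beta>(1) by (intro order_trans[OF abs_triangle_ineq]) (simp add: abs_mult)
          also have "\<dots> \<le> e / 4 + 1 * (e / 4)"
            using 1 2 \<beta> by (intro add_mono mult_mono) auto
          finally show ?thesis by simp
        qed
        have "\<bar>(\<integral>y. g x' y \<partial>Q x') - (\<integral>y. g x y \<partial>Q x')\<bar> = \<bar>\<integral>y. g x' y - g x y \<partial>Q x'\<bar>"
          using gi[OF x] gi[OF x'] by simp
        also have "\<dots> \<le> (\<integral>y. e / 4 + e / 4 \<partial>Q x')"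
          using gi[OF x] gi[OF x'] gd sp Qx'(1)
          by (intro integral_abs_le_integral Bochner_Integration.integrable_diff)
            (auto simp: prob_space.finite_measure finite_measure.integrable_const)
        also have "\<dots> = e / 2" using Qx'(1) by (simp add: prob_space.prob_space)
        finally have A: "\<bar>(\<integral>y. g x' y \<partial>Q x') - (\<integral>y. g x y \<partial>Q x')\<bar> \<le> e / 2" .
        have "\<bar>(\<integral>y. g x y \<partial>Q x') - (\<integral>y. g x y \<partial>Q x)\<bar> \<le> K * tv_dist (Q x') (Q x)"
          using gm[OF x] gb[OF x] sp Qx Qx' K(1) by (intro integral_diff_le_tv_dist) auto
        also have "\<dots> < e / 4" using elim(3) K(1) by (simp add: field_simps)
        finally show "\<bar>f x' - f x\<bar> < e"
          using A e unfolding f cost_to_go.simps g_def[symmetric] by linarith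
      qed
    qed
  qed
qed

end

section \<open>The law of the trajectory\<close>

lemma state_measurable: "state \<in> stage_space X Y U \<rightarrow>\<^sub>M borel_on X"
  and obs_measurable: "obs \<in> stage_space X Y U \<rightarrow>\<^sub>M borel_on Y"
  and action_measurable: "action \<in> stage_space X Y U \<rightarrow>\<^sub>M borel_on U"
  unfolding state_def obs_def action_def by measurable

context pomdp
begin

definition obs_hist :: "nat \<Rightarrow> (nat \<Rightarrow> 'x \<times> 'y \<times> 'u) \<Rightarrow> nat \<Rightarrow> 'y" where
  "obs_hist t h = (\<lambda>i\<in>{..<t}. obs (h i))"

definition action_hist :: "nat \<Rightarrow> (nat \<Rightarrow> 'x \<times> 'y \<times> 'u) \<Rightarrow> nat \<Rightarrow> 'u" where
  "action_hist t h = (\<lambda>i\<in>{..<t}. action (h i))"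

definition state_law :: "'x measure \<Rightarrow> nat \<Rightarrow> (nat \<Rightarrow> 'x \<times> 'y \<times> 'u) \<Rightarrow> 'x measure" where
  "state_law \<mu> t h = (if t = 0 then \<mu> else T (state (h (t - 1))) (action (h (t - 1))))"

text \<open>Discounting starts at t and not at 0, which matches \<open>cost_to_go\<close> and makes
  the one-step recursion independent of t.\<close>

definition partial_cost :: "nat \<Rightarrow> nat \<Rightarrow> (nat \<Rightarrow> 'x \<times> 'y \<times> 'u) \<Rightarrow> real" where
  "partial_cost N t \<omega> = (\<Sum>i<N. \<beta> ^ i * c (state (\<omega> (t + i))) (action (\<omega> (t + i))))"

abbreviation "stages \<equiv> stage_space X Y U"

section \<open>Costs of finitely many stages along a trajectory\<close>

lemma stage_cost_measurable:
  "(\<lambda>s. c (state s) (action s)) \<in> borel_measurable stages"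
  using measurable_compose[OF measurable_Pair[OF state_measurable action_measurable] c_measurable] by simp

lemma stage_cost_bounds:
  "s \<in> space stages \<Longrightarrow> 0 \<le> c (state s) (action s) \<and> c (state s) (action s) \<le> C"
  by (auto simp: space_pair_measure state_def action_def intro!: c)

lemma partial_cost_Suc:
  "partial_cost (Suc N) t \<omega> = c (state (\<omega> t)) (action (\<omega> t)) + \<beta> * partial_cost N (Suc t) \<omega>"
  unfolding partial_cost_def by (simp add: sum.lessThan_Suc_shift sum_distrib_left ac_simps del: sum.lessThan_Suc)

text \<open>The index set J is left open so that the same cost can be read on finite prefixes and on
  whole trajectories.\<close>

lemma partial_cost_measurable:
  assumes "{t..<t + N} \<subseteq> J"
  shows "partial_cost N t \<in> borel_measurable (PiM J (\<lambda>_. stages))"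
  unfolding partial_cost_def[abs_def]
proof (intro borel_measurable_sum borel_measurable_times borel_measurable_const)
  fix i assume "i \<in> {..<N}"
  then have "t + i \<in> J" using assms by auto
  from measurable_compose[OF measurable_component_singleton[OF this] stage_cost_measurable]
  show "(\<lambda>\<omega>. c (state (\<omega> (t + i))) (action (\<omega> (t + i)))) \<in> borel_measurable (PiM J (\<lambda>_. stages))" .
qed

lemma partial_cost_bounds:
  assumes "{t..<t + N} \<subseteq> J" "\<omega> \<in> space (PiM J (\<lambda>_. stages))"
  shows "0 \<le> partial_cost N t \<omega> \<and> partial_cost N t \<omega> \<le> K"
  using assms(1)
proof (induction N arbitrary: t)
  case 0 then show ?case using K(1) by (simp add: partial_cost_def)
next
  case (Suc N)
  have "t \<in> J" using Suc.prems by auto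
  then have "\<omega> t \<in> space stages" using assms(2) by (auto simp: space_PiM PiE_iff)
  note b = stage_cost_bounds[OF this]
  have S: "0 \<le> partial_cost N (Suc t) \<omega>" "partial_cost N (Suc t) \<omega> \<le> K"
    using Suc.IH[of "Suc t"] subset_trans[OF _ Suc.prems, of "{Suc t..<Suc t + N}"] by auto
  have "\<beta> * partial_cost N (Suc t) \<omega> \<le> \<beta> * K"
    using S(2) \<beta>(1) by (intro mult_left_mono) auto
  then show ?case
    using b S(1) \<beta>(1) K(2) mult_nonneg_nonneg[of \<beta> "partial_cost N (Suc t) \<omega>"]
    unfolding partial_cost_Suc by linarith
qed

section \<open>Histories and the one-stage kernel\<close>

lemma history_space:
  assumes "h \<in> space (PiM {0..<t} (\<lambda>_. stages))"
  shows "(obs_hist t h, action_hist t h) \<in> space (info_space Y U t)"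
proof -
  have "h i \<in> space stages" if "i < t" for i
    using assms that by (auto simp: space_PiM PiE_iff)
  then have "obs (h i) \<in> Y \<and> action (h i) \<in> U" if "i < t" for i
    using measurable_space[OF obs_measurable, of "h i" X Y U] that
      measurable_space[OF action_measurable, of "h i" X Y U] by simp
  then show ?thesis
    by (auto simp: space_pair_measure space_PiM obs_hist_def action_hist_def)
qed

lemma state_law_space:
  assumes "\<mu> \<in> space (prob_algebra (borel_on X))" "h \<in> space (PiM {0..<t} (\<lambda>_. stages))"
  shows "state_law \<mu> t h \<in> space (prob_algebra (borel_on X))"
proof (cases t)
  case 0 then show ?thesis using assms(1) by (simp add: state_law_def)
next
  case (Suc n)
  then have "h n \<in> space stages" using assms(2) by (auto simp: space_PiM PiE_iff)
  then have "state (h n) \<in> X" "action (h n) \<in> U"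
    using measurable_space[OF state_measurable, of "h n" X Y U]
      measurable_space[OF action_measurable, of "h n" X Y U] by simp_all
  then show ?thesis using Suc T_space by (simp add: state_law_def)
qed

lemma stage_kernel_eq:
  "stage_kernel X Y U Q T \<mu> \<gamma> t h =
     do { x \<leftarrow> state_law \<mu> t h; y \<leftarrow> Q x;
          return stages (x, y, \<gamma> t ((obs_hist t h)(t := y)) (action_hist t h)) }"
proof -
  have "(\<lambda>i\<in>{..t}. if i < t then obs (h i) else y) = (obs_hist t h)(t := y)" for y
    by (auto simp: obs_hist_def fun_eq_iff restrict_def)
  then show ?thesis
    by (simp add: stage_kernel_def state_law_def action_hist_def)
qed

text \<open>Opens the two monadic binds into an iterated integral over state and observation, the
  shape in which \<open>cost_to_go\<close> is defined.\<close>

lemma integral_stage_kernel: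
  fixes F :: "'x \<times> 'y \<times> 'u \<Rightarrow> real"
  assumes \<mu>: "\<mu> \<in> space (prob_algebra (borel_on X))" and \<gamma>: "\<gamma> \<in> admissible_policies Y U"
    and h: "h \<in> space (PiM {0..<t} (\<lambda>_. stages))"
    and F: "F \<in> borel_measurable stages" "\<And>s. s \<in> space stages \<Longrightarrow> 0 \<le> F s \<and> F s \<le> B"
  shows "(\<integral>s. F s \<partial>stage_kernel X Y U Q T \<mu> \<gamma> t h) =
    (\<integral>x. (\<integral>y. F (x, y, \<gamma> t ((obs_hist t h)(t := y)) (action_hist t h)) \<partial>Q x) \<partial>state_law \<mu> t h)"
proof -
  let ?u = "\<lambda>y. \<gamma> t ((obs_hist t h)(t := y)) (action_hist t h)"
  have i: "(\<lambda>_. (obs_hist t h, action_hist t h)) \<in> borel_on Y \<rightarrow>\<^sub>M info_space Y U t"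
    using history_space[OF h] by simp
  have u: "?u \<in> borel_on Y \<rightarrow>\<^sub>M borel_on U"
    using control_measurable[OF \<gamma> i measurable_ident] by (simp add: id_def)
  have r: "(\<lambda>(x, y). return stages (x, y, ?u y)) \<in> borel_on X \<Otimes>\<^sub>M borel_on Y \<rightarrow>\<^sub>M prob_algebra stages"
  proof -
    have "(\<lambda>p. (fst p, snd p, ?u (snd p))) \<in> borel_on X \<Otimes>\<^sub>M borel_on Y \<rightarrow>\<^sub>M stages"
      by (intro measurable_Pair measurable_fst measurable_snd measurable_compose[OF measurable_snd u])
    from measurable_compose[OF this measurable_return_prob_space] show ?thesis
      by (simp add: split_beta')
  qed
  have b: "(\<lambda>x. Q x \<bind> (\<lambda>y. return stages (x, y, ?u y))) \<in> borel_on X \<rightarrow>\<^sub>M prob_algebra stages"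
    by (rule measurable_bind_prob_space2[OF Q r])
  note L = state_law_space[OF \<mu> h]
  have Lp: "prob_space (state_law \<mu> t h)" "sets (state_law \<mu> t h) = sets (borel_on X)"
    using L by (auto simp: space_prob_algebra)
  have Lsp: "space (state_law \<mu> t h) = X" using sets_eq_imp_space_eq[OF Lp(2)] by simp
  have FB: "\<bar>F s\<bar> \<le> B" if "s \<in> space stages" for s using F(2)[OF that] by simp
  have "(\<integral>s. F s \<partial>stage_kernel X Y U Q T \<mu> \<gamma> t h) =
      (\<integral>x. (\<integral>s. F s \<partial>(Q x \<bind> (\<lambda>y. return stages (x, y, ?u y)))) \<partial>state_law \<mu> t h)"
    unfolding stage_kernel_eq
  proof (rule integral_bind[where K=stages and B=B and B'=1])
    show "(\<lambda>x. Q x \<bind> (\<lambda>y. return stages (x, y, ?u y))) \<in> state_law \<mu> t h \<rightarrow>\<^sub>M subprob_algebra stages"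
      using measurable_prob_algebraD[OF b] Lp(2) by (simp cong: measurable_cong_sets)
    show "AE x in state_law \<mu> t h. emeasure (Q x \<bind> (\<lambda>y. return stages (x, y, ?u y)))
        (space (Q x \<bind> (\<lambda>y. return stages (x, y, ?u y)))) \<le> ennreal 1"
      using measurable_space[OF b] Lsp
      by (intro AE_I2) (simp add: space_prob_algebra prob_space.emeasure_space_1)
  qed (use F(1) FB Lp(1) in \<open>auto simp: prob_space.finite_measure\<close>)
  also have "\<dots> = (\<integral>x. (\<integral>y. F (x, y, ?u y) \<partial>Q x) \<partial>state_law \<mu> t h)"
  proof (rule Bochner_Integration.integral_cong[OF refl])
    fix x assume "x \<in> space (state_law \<mu> t h)"
    then have x: "x \<in> X" by (simp add: Lsp)
    have Qp: "prob_space (Q x)" "sets (Q x) = sets (borel_on Y)"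
      using Q_space[OF x] by (auto simp: space_prob_algebra)
    have Qsp: "space (Q x) = Y" using sets_eq_imp_space_eq[OF Qp(2)] by simp
    have rx: "(\<lambda>y. return stages (x, y, ?u y)) \<in> borel_on Y \<rightarrow>\<^sub>M prob_algebra stages"
      using measurable_compose[OF measurable_Pair1'[of x "borel_on X"] r] x by simp
    have "(\<integral>s. F s \<partial>(Q x \<bind> (\<lambda>y. return stages (x, y, ?u y)))) =
        (\<integral>y. (\<integral>s. F s \<partial>return stages (x, y, ?u y)) \<partial>Q x)"
    proof (rule integral_bind[where K=stages and B=B and B'=1])
      show "(\<lambda>y. return stages (x, y, ?u y)) \<in> Q x \<rightarrow>\<^sub>M subprob_algebra stages"
        using measurable_prob_algebraD[OF rx] Qp(2) by (simp cong: measurable_cong_sets)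
      show "AE y in Q x. emeasure (return stages (x, y, ?u y)) (space (return stages (x, y, ?u y))) \<le> ennreal 1"
        using measurable_space[OF rx] Qsp
        by (intro AE_I2) (simp only: space_prob_algebra mem_Collect_eq prob_space.emeasure_space_1 space_borel_on ennreal_1 order_refl)
    qed (use F(1) FB Qp(1) in \<open>auto simp: prob_space.finite_measure\<close>)
    also have "\<dots> = (\<integral>y. F (x, y, ?u y) \<partial>Q x)"
    proof (rule Bochner_Integration.integral_cong[OF refl])
      fix y assume "y \<in> space (Q x)"
      then have "(x, y, ?u y) \<in> space stages"
        using x measurable_space[OF u] Qsp by (auto simp: space_pair_measure)
      then show "(\<integral>s. F s \<partial>return stages (x, y, ?u y)) = F (x, y, ?u y)"
        using F(1) by (rule integral_return)
    qed
    finally show "(\<integral>s. F s \<partial>(Q x \<bind> (\<lambda>y. return stages (x, y, ?u y)))) = (\<integral>y. F (x, y, ?u y) \<partial>Q x)" .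
  qed
  finally show ?thesis .
qed

text \<open>Appending a stage changes the past exactly as in \<open>stage_value\<close>, and the
  next state law no longer involves the prior.\<close>

lemma history_update:
  "obs_hist (Suc t) (h(t := (x, y, u))) = (obs_hist t h)(t := y)"
  "action_hist (Suc t) (h(t := (x, y, u))) = (action_hist t h)(t := u)"
  "state_law \<mu> (Suc t) (h(t := (x, y, u))) = T x u"
proof -
  show "obs_hist (Suc t) (h(t := (x, y, u))) = (obs_hist t h)(t := y)"
  proof
    fix i show "obs_hist (Suc t) (h(t := (x, y, u))) i = ((obs_hist t h)(t := y)) i"
      by (cases "i = t") (auto simp: obs_hist_def obs_def)
  qed
  show "action_hist (Suc t) (h(t := (x, y, u))) = (action_hist t h)(t := u)"
  proof
    fix i show "action_hist (Suc t) (h(t := (x, y, u))) i = ((action_hist t h)(t := u)) i"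
      by (cases "i = t") (auto simp: action_hist_def action_def)
  qed
  show "state_law \<mu> (Suc t) (h(t := (x, y, u))) = T x u"
    by (simp add: state_law_def state_def action_def)
qed

text \<open>Links the trajectory measure to the recursion, which is written without it. The
  induction needs t and h arbitrary: the first stage is split off the trajectory kernel, and the
  hypothesis is applied to the lengthened history.\<close>

lemma integral_partial_cost:
  assumes \<mu>: "\<mu> \<in> space (prob_algebra (borel_on X))" and \<gamma>: "\<gamma> \<in> admissible_policies Y U"
    and h: "h \<in> space (PiM {0..<t} (\<lambda>_. stages))"
  shows "(\<integral>\<omega>. partial_cost N t \<omega> \<partial>Ionescu_Tulcea.C (stage_kernel X Y U Q T \<mu> \<gamma>) (\<lambda>_. stages) t N h) =
    (\<integral>x. cost_to_go \<gamma> N t (obs_hist t h) (action_hist t h) x \<partial>state_law \<mu> t h)"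
proof -
  interpret IT: Ionescu_Tulcea "stage_kernel X Y U Q T \<mu> \<gamma>" "\<lambda>_. stages"
    by (rule Ionescu_Tulcea_stage_kernel[OF \<mu> Q T \<gamma>])
  show ?thesis
    using h
  proof (induction N arbitrary: t h)
    case 0 then show ?case by (simp add: partial_cost_def)
  next
    case (Suc N)
    note h = Suc.prems
    let ?M = "\<lambda>t. PiM {0..<t} (\<lambda>_. stages)"
    \<comment> \<open>The conditional expected cost given the history up to and including stage
      t.\<close>
    define F where "F \<omega>' = (\<integral>\<omega>. partial_cost (Suc N) t \<omega> \<partial>IT.C (Suc t) N \<omega>')" for \<omega>'
    have pm: "partial_cost (Suc N) t \<in> borel_measurable (?M (Suc t + N))"
      by (rule partial_cost_measurable) auto
    have pb: "0 \<le> partial_cost (Suc N) t \<omega> \<and> partial_cost (Suc N) t \<omega> \<le> K"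
      if "\<omega> \<in> space (?M (Suc t + N))" for \<omega>
      using that by (intro partial_cost_bounds[where J="{0..<Suc t + N}"]) auto
    have Fm: "F \<in> borel_measurable (?M (Suc t))"
      unfolding F_def[abs_def]
      by (rule measurable_compose[OF IT.measurable_C integral_measurable_subprob_algebra[OF pm]])
    have Fb: "0 \<le> F \<omega>' \<and> F \<omega>' \<le> K" if w: "\<omega>' \<in> space (?M (Suc t))" for \<omega>'
      using prob_integral_bounds(2,3)[OF IT.prob_space_C[OF w], of "partial_cost (Suc N) t" N K] pm pb
      unfolding F_def measurable_cong_sets[OF IT.sets_C[OF w] refl] IT.space_C[OF w] by blast
    have Fv: "F \<omega>' = c (state (\<omega>' t)) (action (\<omega>' t)) + \<beta> *
        (\<integral>x. cost_to_go \<gamma> N (Suc t) (obs_hist (Suc t) \<omega>') (action_hist (Suc t) \<omega>') x \<partial>state_law \<mu> (Suc t) \<omega>')"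
      if w: "\<omega>' \<in> space (?M (Suc t))" for \<omega>'
    proof -
      interpret P: prob_space "IT.C (Suc t) N \<omega>'" by (rule IT.prob_space_C[OF w])
      note S = IT.sets_C[OF w, of N] and sp = IT.space_C[OF w, of N]
      have "partial_cost N (Suc t) \<in> borel_measurable (?M (Suc t + N))"
        by (rule partial_cost_measurable) auto
      then have p1: "partial_cost N (Suc t) \<in> borel_measurable (IT.C (Suc t) N \<omega>')"
        using S by (simp cong: measurable_cong_sets)
      have "0 \<le> partial_cost N (Suc t) \<omega> \<and> partial_cost N (Suc t) \<omega> \<le> K"
        if "\<omega> \<in> space (IT.C (Suc t) N \<omega>')" for \<omega>
        using that unfolding sp by (intro partial_cost_bounds[where J="{0..<Suc t + N}"]) auto
      then have i1: "integrable (IT.C (Suc t) N \<omega>') (partial_cost N (Suc t))"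
        by (rule prob_integral_bounds(1)[OF P.prob_space_axioms p1])
      let ?c = "\<lambda>\<omega>. c (state (\<omega> t)) (action (\<omega> t))"
      have cm: "?c \<in> borel_measurable (PiM J (\<lambda>_. stages))" if "t \<in> J" for J
        by (rule measurable_compose[OF measurable_component_singleton[OF that] stage_cost_measurable])
      have c1: "?c \<in> borel_measurable (IT.C (Suc t) N \<omega>')"
        using cm[of "{0..<Suc t + N}"] S by (simp cong: measurable_cong_sets)
      have "0 \<le> ?c \<omega> \<and> ?c \<omega> \<le> C" if "\<omega> \<in> space (IT.C (Suc t) N \<omega>')" for \<omega>
        using that unfolding sp by (intro stage_cost_bounds) (auto simp: space_PiM PiE_iff)
      then have i2: "integrable (IT.C (Suc t) N \<omega>') ?c"
        by (rule prob_integral_bounds(1)[OF P.prob_space_axioms c1])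
      have rm: "(\<lambda>\<omega>. restrict \<omega> {0..<Suc t}) \<in> IT.C (Suc t) N \<omega>' \<rightarrow>\<^sub>M ?M (Suc t)"
        unfolding measurable_cong_sets[OF S refl] by (rule measurable_restrict_subset) auto
      \<comment> \<open>Later stages leave the coordinates up to t untouched: the marginal on them
        is the point mass at \<open>\<omega>'\<close>, so the cost of stage t is already
        determined.\<close>
      have "(\<integral>\<omega>. ?c \<omega> \<partial>IT.C (Suc t) N \<omega>') = (\<integral>\<omega>. ?c (restrict \<omega> {0..<Suc t}) \<partial>IT.C (Suc t) N \<omega>')"
        by simp
      also have "\<dots> = (\<integral>\<omega>. ?c \<omega> \<partial>distr (IT.C (Suc t) N \<omega>') (?M (Suc t)) (\<lambda>\<omega>. restrict \<omega> {0..<Suc t}))"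
        by (rule integral_distr[symmetric, OF rm cm]) simp
      also have "\<dots> = (\<integral>\<omega>. ?c \<omega> \<partial>return (?M (Suc t)) \<omega>')"
        using IT.distr_C[OF le0 w, of N] by simp
      also have "\<dots> = ?c \<omega>'"
        by (rule integral_return[OF w cm]) simp
      finally have "(\<integral>\<omega>. ?c \<omega> \<partial>IT.C (Suc t) N \<omega>') = ?c \<omega>'" .
      then show ?thesis
        unfolding F_def partial_cost_Suc Suc.IH[OF w, symmetric] using i1 i2 by simp
    qed
    have eq: "IT.C t (Suc N) h = IT.eP t h \<bind> IT.C (Suc t) N"
      using IT.split_C[OF h, of 1 N] bind_return[OF IT.measurable_eP h] by simp
    have upd: "fun_upd h t \<in> stage_kernel X Y U Q T \<mu> \<gamma> t h \<rightarrow>\<^sub>M ?M (Suc t)"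
      unfolding measurable_cong_sets[OF IT.sets_P[OF h] refl]
      by (rule measurable_fun_upd[where J="{0..<t}"]) (use h in \<open>auto\<close>)
    have hs: "h(t := s) \<in> space (?M (Suc t))" if "s \<in> space stages" for s
      using measurable_space[OF upd] that by (simp add: IT.space_P[OF h])
    have Fu: "(\<lambda>s. F (h(t := s))) \<in> borel_measurable stages"
      using measurable_compose[OF upd Fm] by (simp add: measurable_cong_sets[OF IT.sets_P[OF h] refl])
    have "(\<integral>\<omega>. partial_cost (Suc N) t \<omega> \<partial>IT.C t (Suc N) h) = (\<integral>\<omega>'. F \<omega>' \<partial>IT.eP t h)"
      unfolding eq F_def
    proof (rule integral_bind[where K="?M (Suc t + N)" and B=K and B'=1])
      show "IT.C (Suc t) N \<in> IT.eP t h \<rightarrow>\<^sub>M subprob_algebra (?M (Suc t + N))"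
        unfolding measurable_cong_sets[OF IT.sets_eP[OF h] refl] by (rule IT.measurable_C)
      show "finite_measure (IT.eP t h)"
        using IT.prob_space_eP[OF h] by (rule prob_space.finite_measure)
      show "AE x in IT.eP t h. emeasure (IT.C (Suc t) N x) (space (IT.C (Suc t) N x)) \<le> ennreal 1"
        using IT.space_eP[OF h] by (intro AE_I2) (simp add: IT.prob_space_C prob_space.emeasure_space_1)
    qed (use pm pb in auto)
    also have "\<dots> = (\<integral>s. F (h(t := s)) \<partial>stage_kernel X Y U Q T \<mu> \<gamma> t h)"
      unfolding IT.eP_def by (rule integral_distr[OF upd Fm])
    also have "\<dots> = (\<integral>x. (\<integral>y. F (h(t := (x, y, \<gamma> t ((obs_hist t h)(t := y)) (action_hist t h)))) \<partial>Q x) \<partial>state_law \<mu> t h)"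
      by (rule integral_stage_kernel[OF \<mu> \<gamma> h Fu]) (rule Fb[OF hs])
    also have "\<dots> = (\<integral>x. cost_to_go \<gamma> (Suc N) t (obs_hist t h) (action_hist t h) x \<partial>state_law \<mu> t h)"
      unfolding cost_to_go.simps
    proof (intro Bochner_Integration.integral_cong refl)
      fix x y assume x: "x \<in> space (state_law \<mu> t h)" and y: "y \<in> space (Q x)"
      have "sets (state_law \<mu> t h) = sets (borel_on X)"
        using state_law_space[OF \<mu> h] by (auto simp: space_prob_algebra)
      from sets_eq_imp_space_eq[OF this] x have x: "x \<in> X" by simp
      have "sets (Q x) = sets (borel_on Y)"
        using Q_space[OF x] by (auto simp: space_prob_algebra)
      from sets_eq_imp_space_eq[OF this] y have y: "y \<in> Y" by simp
      let ?u = "\<gamma> t ((obs_hist t h)(t := y)) (action_hist t h)"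
      have "(x, y, ?u) \<in> space stages"
        using x y info_update_space(1)[OF \<gamma> history_space[OF h] y] by (simp add: space_pair_measure)
      from Fv[OF hs[OF this]]
      show "F (h(t := (x, y, ?u))) = stage_value (cost_to_go \<gamma> N) \<gamma> t (obs_hist t h) (action_hist t h) x y"
        unfolding history_update stage_value_def Let_def by (simp add: state_def action_def)
    qed
    finally show ?case .
  qed
qed

section \<open>Dependence on the prior\<close>

lemma discounted_sum_approx:
  assumes "\<omega> \<in> space (PiM UNIV (\<lambda>_. stages))"
  shows "\<bar>(\<Sum>t. \<beta> ^ t * c (state (\<omega> t)) (action (\<omega> t))) - partial_cost N 0 \<omega>\<bar> \<le> \<beta> ^ N * K"
proof -
  let ?a = "\<lambda>t. \<beta> ^ t * c (state (\<omega> t)) (action (\<omega> t))"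
  have a: "0 \<le> ?a t" "?a t \<le> \<beta> ^ t * C" for t
    using stage_cost_bounds[of "\<omega> t"] assms \<beta>(1)
    by (auto simp: space_PiM PiE_iff intro!: mult_left_mono)
  have g: "(\<lambda>t. \<beta> ^ t * C) sums (1 / (1 - \<beta>) * C)"
    using \<beta> by (intro sums_mult2 geometric_sums) simp
  have s: "summable ?a"
    using a by (intro summable_comparison_test[OF _ sums_summable[OF g]]) auto
  have "(\<lambda>t. \<beta> ^ N * (\<beta> ^ t * C)) sums (\<beta> ^ N * (1 / (1 - \<beta>) * C))"
    by (intro sums_mult g)
  then have gN: "(\<lambda>t. \<beta> ^ (t + N) * C) sums (\<beta> ^ N * K)"
    by (simp add: power_add K_def ac_simps)
  have "(\<Sum>t. ?a t) - partial_cost N 0 \<omega> = (\<Sum>t. ?a (t + N))"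
    using suminf_minus_initial_segment[OF s, of N] by (simp add: partial_cost_def)
  moreover have "0 \<le> (\<Sum>t. ?a (t + N))"
    using a summable_ignore_initial_segment[OF s, of N] by (intro suminf_nonneg) auto
  moreover have "(\<Sum>t. ?a (t + N)) \<le> \<beta> ^ N * K"
    unfolding sums_unique[OF gN] using a
    by (intro suminf_le summable_ignore_initial_segment[OF s] sums_summable[OF gN])
  ultimately show "\<bar>(\<Sum>t. ?a t) - partial_cost N 0 \<omega>\<bar> \<le> \<beta> ^ N * K" by simp
qed

text \<open>The law of the first N stages gives the truncated cost, and the geometric tail bounds
  the rest uniformly over trajectories, and hence over priors and policies.\<close>

lemma discounted_cost_approx:
  assumes \<mu>: "\<mu> \<in> space (prob_algebra (borel_on X))" and \<gamma>: "\<gamma> \<in> admissible_policies Y U"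
  shows "\<bar>discounted_cost X Y U Q c \<beta> \<mu> T \<gamma> -
    (\<integral>x. cost_to_go \<gamma> N 0 (\<lambda>_. undefined) (\<lambda>_. undefined) x \<partial>\<mu>)\<bar> \<le> \<beta> ^ N * K"
proof -
  interpret IT: Ionescu_Tulcea "stage_kernel X Y U Q T \<mu> \<gamma>" "\<lambda>_. stages"
    by (rule Ionescu_Tulcea_stage_kernel[OF \<mu> Q T \<gamma>])
  \<comment> \<open>The only point of a product over the empty index set, that is, the empty
    past.\<close>
  let ?u = "\<lambda>_. undefined" and ?M = "\<lambda>J. PiM J (\<lambda>_. stages)"
  define L where "L = trajectory_law X Y U Q T \<mu> \<gamma>"
  have L: "L = IT.PF.lim" by (simp add: L_def trajectory_law_def)
  have sets: "sets L = sets (?M UNIV)" unfolding L by simp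
  have space: "space L = space (?M UNIV)" by (rule sets_eq_imp_space_eq[OF sets])
  have rm: "(\<lambda>\<omega>. restrict \<omega> {0..<N}) \<in> L \<rightarrow>\<^sub>M ?M {0..<N}"
    unfolding measurable_cong_sets[OF sets refl] by (rule measurable_restrict_subset) simp
  \<comment> \<open>\<open>up_to\<close> is the length of the shortest prefix containing an index
    set. For {0..<N} it is N, so the finite-dimensional marginal is the N-step kernel
    itself.\<close>
  have "IT.up_to {0..<N} \<le> N" using IT.up_to_iff_Ico[of "{0..<N}" N] by simp
  moreover have "N \<le> IT.up_to {0..<N}" using IT.up_to[of "{0..<N}"] by (cases N) auto
  ultimately have "IT.up_to {0..<N} = N" by (rule le_antisym)
  then have "IT.CI {0..<N} = IT.C 0 N ?u"
    using IT.distr_C[of N N ?u 0] by (simp add: IT.CI_def space_PiM)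
  then have dL: "distr L (?M {0..<N}) (\<lambda>\<omega>. restrict \<omega> {0..<N}) = IT.C 0 N ?u"
    unfolding L by (simp add: IT.distr_lim)
  have "prob_space (IT.C 0 N ?u)" by (rule IT.prob_space_C) (simp add: space_PiM)
  then have pL: "prob_space L"
    unfolding dL[symmetric] by (rule prob_space_distrD[OF rm])
  have pm: "partial_cost N 0 \<in> borel_measurable (?M {0..<N})"
    by (rule partial_cost_measurable) simp
  have "partial_cost N 0 \<omega> = partial_cost N 0 (restrict \<omega> {0..<N})" for \<omega>
    by (auto simp: partial_cost_def intro!: sum.cong)
  then have "(\<integral>\<omega>. partial_cost N 0 \<omega> \<partial>L) = (\<integral>\<omega>. partial_cost N 0 (restrict \<omega> {0..<N}) \<partial>L)"
    by (intro Bochner_Integration.integral_cong) auto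
  also have "\<dots> = (\<integral>\<omega>. partial_cost N 0 \<omega> \<partial>IT.C 0 N ?u)"
    unfolding dL[symmetric] by (rule integral_distr[symmetric, OF rm pm])
  also have "\<dots> = (\<integral>x. cost_to_go \<gamma> N 0 (obs_hist 0 ?u) (action_hist 0 ?u) x \<partial>state_law \<mu> 0 ?u)"
    by (rule integral_partial_cost[OF \<mu> \<gamma>]) (simp add: space_PiM)
  also have "\<dots> = (\<integral>x. cost_to_go \<gamma> N 0 ?u ?u x \<partial>\<mu>)"
    by (simp add: obs_hist_def action_hist_def state_law_def restrict_def)
  finally have eq: "(\<integral>\<omega>. partial_cost N 0 \<omega> \<partial>L) = (\<integral>x. cost_to_go \<gamma> N 0 ?u ?u x \<partial>\<mu>)" .
  have pmL: "partial_cost N 0 \<in> borel_measurable L"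
    unfolding measurable_cong_sets[OF sets refl] by (rule partial_cost_measurable) simp
  have ip: "integrable L (partial_cost N 0)"
    using prob_integral_bounds(1)[OF pL pmL, of K] partial_cost_bounds[of 0 N UNIV] unfolding space by blast
  let ?S = "\<lambda>\<omega>. \<Sum>t. \<beta> ^ t * c (state (\<omega> t)) (action (\<omega> t))"
  have Sm: "?S \<in> borel_measurable L"
    unfolding measurable_cong_sets[OF sets refl]
  proof (intro borel_measurable_suminf borel_measurable_times borel_measurable_const)
    fix t :: nat
    have "(\<lambda>\<omega>. \<omega> t) \<in> ?M UNIV \<rightarrow>\<^sub>M stages" by (rule measurable_component_singleton) simp
    from measurable_compose[OF this stage_cost_measurable]
    show "(\<lambda>\<omega>. c (state (\<omega> t)) (action (\<omega> t))) \<in> borel_measurable (?M UNIV)" .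
  qed
  have dm: "(\<lambda>\<omega>. ?S \<omega> - partial_cost N 0 \<omega>) \<in> borel_measurable L"
    using Sm pmL by (rule borel_measurable_diff)
  have id: "integrable L (\<lambda>\<omega>. ?S \<omega> - partial_cost N 0 \<omega>)"
    using discounted_sum_approx space
    by (intro finite_measure.integrable_const_bound[OF prob_space.finite_measure[OF pL] _ dm, of "\<beta> ^ N * K"] AE_I2) simp
  then have iS: "integrable L ?S"
    using Bochner_Integration.integrable_add[OF id ip] by simp
  have "discounted_cost X Y U Q c \<beta> \<mu> T \<gamma> - (\<integral>x. cost_to_go \<gamma> N 0 ?u ?u x \<partial>\<mu>) =
      (\<integral>\<omega>. ?S \<omega> - partial_cost N 0 \<omega> \<partial>L)"
    unfolding eq[symmetric] discounted_cost_def L_def[symmetric] using iS ip by simp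
  also have "\<bar>\<dots>\<bar> \<le> (\<integral>\<omega>. \<beta> ^ N * K \<partial>L)"
    by (rule integral_abs_le_integral[OF id])
      (auto simp: space discounted_sum_approx intro!: finite_measure.integrable_const[OF prob_space.finite_measure[OF pL]])
  also have "\<dots> = \<beta> ^ N * K" using pL by (simp add: prob_space.prob_space)
  finally show ?thesis .
qed

text \<open>The test functions and d depend on \<mu> and e but not on the policy, because for a
  fixed horizon all policies contribute to one family. The error consists of two truncations and one
  difference of N-stage costs.\<close>

lemma discounted_cost_close:
  assumes \<mu>: "\<mu> \<in> space (prob_algebra (borel_on X))" and e: "e > 0"
  shows "\<exists>(\<Phi> :: ('x \<Rightarrow> real) set) d. finite \<Phi> \<and> d > 0 \<and>
    (\<forall>\<phi>\<in>\<Phi>. continuous_on UNIV \<phi> \<and> (\<forall>x. \<phi> x \<in> {0..1})) \<and>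
    (\<forall>\<nu>\<in>space (prob_algebra (borel_on X)).
       (\<forall>\<phi>\<in>\<Phi>. \<bar>(\<integral>x. \<phi> x \<partial>\<nu>) - (\<integral>x. \<phi> x \<partial>\<mu>)\<bar> < d) \<longrightarrow>
       (\<forall>\<gamma>\<in>admissible_policies Y U.
          \<bar>discounted_cost X Y U Q c \<beta> \<nu> T \<gamma> - discounted_cost X Y U Q c \<beta> \<mu> T \<gamma>\<bar> < e))"
proof -
  have e4: "e / 4 > 0" using e by simp
  have "(\<lambda>N. \<beta> ^ N * K) \<longlonglongrightarrow> 0 * K"
    using \<beta> by (intro tendsto_mult tendsto_const LIMSEQ_power_zero) auto
  then have "\<forall>\<^sub>F N in sequentially. \<beta> ^ N * K < e / 4"
    using e4 by (intro order_tendstoD) auto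
  then obtain N where N: "\<beta> ^ N * K < e / 4" by (auto simp: eventually_sequentially)
  from integral_close_on_equicontinuous[OF \<mu> equicontinuous_cost_family[of N] less_imp_le[OF K(1)]
      cost_family_bounded e4]
  obtain \<Phi> :: "('x \<Rightarrow> real) set" and d where \<Phi>: "finite \<Phi>" "d > 0"
    "\<forall>\<phi>\<in>\<Phi>. continuous_on UNIV \<phi> \<and> (\<forall>x. \<phi> x \<in> {0..1})" and
    close: "\<forall>\<nu>\<in>space (prob_algebra (borel_on X)).
       (\<forall>\<phi>\<in>\<Phi>. \<bar>(\<integral>x. \<phi> x \<partial>\<nu>) - (\<integral>x. \<phi> x \<partial>\<mu>)\<bar> < d) \<longrightarrow>
       (\<forall>f\<in>cost_family N. \<bar>(\<integral>x. f x \<partial>\<nu>) - (\<integral>x. f x \<partial>\<mu>)\<bar> < e / 4)"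
    by (elim exE conjE) (rule that)
  show ?thesis
  proof (rule exI[of _ \<Phi>], rule exI[of _ d], intro conjI ballI impI)
    fix \<nu> \<gamma>
    assume \<nu>: "\<nu> \<in> space (prob_algebra (borel_on X))"
      and cl: "\<forall>\<phi>\<in>\<Phi>. \<bar>(\<integral>x. \<phi> x \<partial>\<nu>) - (\<integral>x. \<phi> x \<partial>\<mu>)\<bar> < d"
      and \<gamma>: "\<gamma> \<in> admissible_policies Y U"
    let ?f = "cost_to_go \<gamma> N 0 (\<lambda>_. undefined) (\<lambda>_. undefined)"
    have "((\<lambda>_. undefined), (\<lambda>_. undefined)) \<in> space (info_space Y U 0)"
      by (simp add: space_pair_measure space_PiM)
    then have "?f \<in> cost_family N" using \<gamma> unfolding cost_family_def by blast
    then have "\<bar>(\<integral>x. ?f x \<partial>\<nu>) - (\<integral>x. ?f x \<partial>\<mu>)\<bar> < e / 4" using close \<nu> cl by blast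
    with discounted_cost_approx[OF \<nu> \<gamma>, of N] discounted_cost_approx[OF \<mu> \<gamma>, of N] N
    show "\<bar>discounted_cost X Y U Q c \<beta> \<nu> T \<gamma> - discounted_cost X Y U Q c \<beta> \<mu> T \<gamma>\<bar> < e"
      by linarith
  qed (use \<Phi> in auto)
qed

text \<open>The truncation estimate for the horizon 0, where the truncated cost vanishes.\<close>

lemma discounted_cost_bound:
  assumes "\<mu> \<in> space (prob_algebra (borel_on X))" "\<gamma> \<in> admissible_policies Y U"
  shows "\<bar>discounted_cost X Y U Q c \<beta> \<mu> T \<gamma>\<bar> \<le> K"
  using discounted_cost_approx[OF assms, of 0] by simp

text \<open>Infima of two functions that are uniformly e-close differ by at most e. The bound by K
  supplies the lower bounds that real infima require.\<close>

lemma optimal_cost_close: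
  assumes \<mu>: "\<mu> \<in> space (prob_algebra (borel_on X))" and \<nu>: "\<nu> \<in> space (prob_algebra (borel_on X))"
    and e: "e > 0"
    and close: "\<forall>\<gamma>\<in>admissible_policies Y U.
      \<bar>discounted_cost X Y U Q c \<beta> \<nu> T \<gamma> - discounted_cost X Y U Q c \<beta> \<mu> T \<gamma>\<bar> < e"
  shows "\<bar>optimal_cost X Y U Q c \<beta> \<nu> T - optimal_cost X Y U Q c \<beta> \<mu> T\<bar> \<le> e"
proof (cases "admissible_policies Y U = {}")
  \<comment> \<open>Both optimal costs are then the same infimum over the empty set.\<close>
  case True
  then show ?thesis using e by (simp add: optimal_cost_def)
next
  case False
  let ?A = "admissible_policies Y U" and ?J = "\<lambda>\<mu> \<gamma>. discounted_cost X Y U Q c \<beta> \<mu> T \<gamma>"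
  have le: "(INF \<gamma>\<in>?A. ?J \<rho> \<gamma>) - e \<le> (INF \<gamma>\<in>?A. ?J \<sigma> \<gamma>)"
    if \<rho>: "\<rho> \<in> space (prob_algebra (borel_on X))"
      and cl: "\<forall>\<gamma>\<in>?A. \<bar>?J \<sigma> \<gamma> - ?J \<rho> \<gamma>\<bar> < e" for \<rho> \<sigma>
  proof (rule cINF_greatest[OF False])
    fix \<gamma> assume \<gamma>: "\<gamma> \<in> ?A"
    have "bdd_below (?J \<rho> ` ?A)"
      by (rule bdd_belowI2[where m="- K"]) (rule abs_le_D2[OF discounted_cost_bound[OF \<rho>], THEN minus_le_iff[THEN iffD1]])
    from cINF_lower[OF this \<gamma>] bspec[OF cl \<gamma>]
    show "(INF \<gamma>\<in>?A. ?J \<rho> \<gamma>) - e \<le> ?J \<sigma> \<gamma>" by linarith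
  qed
  have "\<forall>\<gamma>\<in>?A. \<bar>?J \<mu> \<gamma> - ?J \<nu> \<gamma>\<bar> < e" using close by (simp add: abs_minus_commute)
  from le[OF \<nu> this] le[OF \<mu> close] show ?thesis
    unfolding optimal_cost_def by linarith
qed

end

theorem theorem4p2:
  fixes X :: "'x::euclidean_space set"
    and Y :: "'y::euclidean_space set"
    and U :: "'u::euclidean_space set"
    and Q :: "'x \<Rightarrow> 'y measure"
    and T :: "'x \<Rightarrow> 'u \<Rightarrow> 'x measure"
    and c :: "'x \<Rightarrow> 'u \<Rightarrow> real"
    and \<beta> :: real
    and P :: "'x measure"
    and \<Omega> :: "'w measure"
    and \<xi> :: "nat \<Rightarrow> 'w \<Rightarrow> 'x"
  assumes "X \<in> sets borel" "Y \<in> sets borel" "U \<in> sets borel"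
    and Q_kernel: "Q \<in> borel_on X \<rightarrow>\<^sub>M prob_algebra (borel_on Y)"
    and T_kernel: "(\<lambda>(x, u). T x u) \<in> borel_on X \<Otimes>\<^sub>M borel_on U \<rightarrow>\<^sub>M prob_algebra (borel_on X)"
    and \<beta>: "0 < \<beta>" "\<beta> < 1"
    and P: "P \<in> space (prob_algebra (borel_on X))"
    and \<Omega>: "prob_space \<Omega>"
    and indep: "prob_space.indep_vars \<Omega> (\<lambda>_. borel_on X) \<xi> {1..}"
    and law: "\<And>i. i \<ge> 1 \<Longrightarrow> distr \<Omega> (borel_on X) (\<xi> i) = P"
    and a: "weakly_continuous X U T"
    and b: "tv_continuous X Q"
    and c: "\<And>x u. x \<in> X \<Longrightarrow> u \<in> U \<Longrightarrow> 0 \<le> c x u"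
           "bounded ((\<lambda>(x, u). c x u) ` (X \<times> U))"
           "continuous_on (X \<times> U) (\<lambda>(x, u). c x u)"
    and d: "compact U"
  shows "(AE \<omega> in \<Omega>.
           (\<lambda>n. optimal_cost X Y U Q c \<beta> (empirical_measure X n (\<lambda>i. \<xi> i \<omega>)) T)
             \<longlonglongrightarrow> optimal_cost X Y U Q c \<beta> P T) \<and>
         (\<forall>\<gamma>_opt :: nat \<Rightarrow> 'w \<Rightarrow> ('y, 'u) policy.
           (\<forall>n\<ge>1. \<forall>\<omega>\<in>space \<Omega>.
              optimal_policy X Y U Q c \<beta> (empirical_measure X n (\<lambda>i. \<xi> i \<omega>)) T (\<gamma>_opt n \<omega>)) \<longrightarrow>
           (AE \<omega> in \<Omega>.
             (\<lambda>n. discounted_cost X Y U Q c \<beta> P T (\<gamma>_opt n \<omega>))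
               \<longlonglongrightarrow> optimal_cost X Y U Q c \<beta> P T))"
proof -
  interpret \<Omega>: prob_space \<Omega> by (rule \<Omega>)
  obtain B where B: "\<And>x u. x \<in> X \<Longrightarrow> u \<in> U \<Longrightarrow> \<bar>c x u\<bar> \<le> B"
    using c(2) unfolding bounded_iff by auto
  \<comment> \<open>Adding 1 makes the cost bound strictly positive even for c = 0, since K is used
    as a divisor.\<close>
  interpret pomdp X Y U Q T c \<beta> "\<bar>B\<bar> + 1"
  proof (unfold_locales, goal_cases)
    case (7 x u)
    then show ?case using c(1)[of x u] B[of x u] by auto
  qed (use Q_kernel T_kernel \<beta> a b c(3) d in auto)
  let ?J = "\<lambda>\<mu> \<gamma>. discounted_cost X Y U Q c \<beta> \<mu> T \<gamma>"
  let ?Jopt = "\<lambda>\<mu>. optimal_cost X Y U Q c \<beta> \<mu> T"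
  let ?P = "\<lambda>n \<omega>. empirical_measure X n (\<lambda>i. \<xi> i \<omega>)"
  let ?A = "admissible_policies Y U"
  have \<xi>: "\<xi> i \<omega> \<in> X" if "i \<ge> 1" "\<omega> \<in> space \<Omega>" for i \<omega>
  proof -
    have "\<xi> i \<in> \<Omega> \<rightarrow>\<^sub>M borel_on X"
      using indep that(1) unfolding \<Omega>.indep_vars_def by auto
    from measurable_space[OF this that(2)] show ?thesis by simp
  qed
  have Pn: "?P n \<omega> \<in> space (prob_algebra (borel_on X))" if "n \<ge> 1" "\<omega> \<in> space \<Omega>" for n \<omega>
    using that \<xi> by (intro empirical_measure_in_prob_algebra) auto
  define close where "close k \<Phi> d \<longleftrightarrow> finite \<Phi> \<and> d > 0 \<and>
    (\<forall>\<phi>\<in>\<Phi>. continuous_on UNIV \<phi> \<and> (\<forall>x. \<phi> x \<in> {0..1})) \<and>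
    (\<forall>\<nu>\<in>space (prob_algebra (borel_on X)).
       (\<forall>\<phi>\<in>\<Phi>. \<bar>(\<integral>x. \<phi> x \<partial>\<nu>) - (\<integral>x. \<phi> x \<partial>P)\<bar> < d) \<longrightarrow>
       (\<forall>\<gamma>\<in>?A. \<bar>?J \<nu> \<gamma> - ?J P \<gamma>\<bar> < 1 / real (Suc k)))"
    for k :: nat and \<Phi> :: "('x \<Rightarrow> real) set" and d :: real
  have "\<forall>k. \<exists>\<Phi> d. close k \<Phi> d"
    unfolding close_def by (intro allI discounted_cost_close[OF P]) simp
  \<comment> \<open>Finitely many test functions for each tolerance 1/(k+1), so countably many in
    all: one null set serves every tolerance and every policy.\<close>
  then obtain \<Phi> d where close: "\<And>k. close k (\<Phi> k) (d k)" by metis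
  have \<Phi>: "finite (\<Phi> k)" "d k > 0"
      "\<phi> \<in> \<Phi> k \<Longrightarrow> continuous_on UNIV \<phi>" "\<phi> \<in> \<Phi> k \<Longrightarrow> \<phi> x \<in> {0..1}" for k \<phi> x
    using close[of k] unfolding close_def by blast+
  have \<phi>_meas: "\<phi> \<in> borel_measurable (borel_on X)" if "\<phi> \<in> \<Phi> k" for \<phi> k
    using continuous_on_borel_on[OF continuous_on_subset[OF \<Phi>(3)[OF that] subset_UNIV]] .
  have "AE \<omega> in \<Omega>. \<forall>\<phi>\<in>\<Phi> k. (\<lambda>n. (\<Sum>i=1..n. \<phi> (\<xi> i \<omega>)) / real n) \<longlonglongrightarrow> (\<integral>x. \<phi> x \<partial>P)" for k
    using \<Phi>(1) by (intro AE_finite_allI \<Omega>.strong_law_bounded[OF indep law] \<phi>_meas \<Phi>(4))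
  then have "AE \<omega> in \<Omega>. \<forall>k. \<forall>\<phi>\<in>\<Phi> k. (\<lambda>n. (\<Sum>i=1..n. \<phi> (\<xi> i \<omega>)) / real n) \<longlonglongrightarrow> (\<integral>x. \<phi> x \<partial>P)"
    unfolding AE_all_countable by blast
  \<comment> \<open>The condition n \<ge> 1 is carried along because for n = 0 the empirical measure
    is the zero measure.\<close>
  with AE_space have unif: "AE \<omega> in \<Omega>. \<omega> \<in> space \<Omega> \<and>
      (\<forall>k::nat. \<forall>\<^sub>F n in sequentially. n \<ge> 1 \<and> (\<forall>\<gamma>\<in>?A. \<bar>?J (?P n \<omega>) \<gamma> - ?J P \<gamma>\<bar> < 1 / real (Suc k)))"
  proof eventually_elim
    case (elim \<omega>)
    show ?case
    proof (intro conjI allI)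
      show "\<omega> \<in> space \<Omega>" by fact
      fix k :: nat
      have "\<forall>\<^sub>F n in sequentially. \<bar>(\<Sum>i=1..n. \<phi> (\<xi> i \<omega>)) / real n - (\<integral>x. \<phi> x \<partial>P)\<bar> < d k" if "\<phi> \<in> \<Phi> k" for \<phi>
        using tendstoD[OF elim(2)[rule_format, OF that] \<Phi>(2)[of k]] by (simp add: dist_real_def)
      then have "\<forall>\<^sub>F n in sequentially. \<forall>\<phi>\<in>\<Phi> k. \<bar>(\<Sum>i=1..n. \<phi> (\<xi> i \<omega>)) / real n - (\<integral>x. \<phi> x \<partial>P)\<bar> < d k"
        using \<Phi>(1) by (intro eventually_ball_finite) auto
      with eventually_ge_at_top[of 1]
      show "\<forall>\<^sub>F n in sequentially. n \<ge> 1 \<and> (\<forall>\<gamma>\<in>?A. \<bar>?J (?P n \<omega>) \<gamma> - ?J P \<gamma>\<bar> < 1 / real (Suc k))"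
      proof eventually_elim
        case n: (elim n)
        have "(\<integral>x. \<phi> x \<partial>?P n \<omega>) = (\<Sum>i=1..n. \<phi> (\<xi> i \<omega>)) / real n" if "\<phi> \<in> \<Phi> k" for \<phi>
          using n(1) \<xi> elim(1) \<phi>_meas[OF that] by (intro integral_empirical_measure) auto
        with n(2) have "\<forall>\<phi>\<in>\<Phi> k. \<bar>(\<integral>x. \<phi> x \<partial>?P n \<omega>) - (\<integral>x. \<phi> x \<partial>P)\<bar> < d k" by simp
        then show ?case using close[of k] Pn[OF n(1) elim(1)] n(1) unfolding close_def by blast
      qed
    qed
  qed
  have opt_conv: "(\<lambda>n. ?Jopt (?P n \<omega>)) \<longlonglongrightarrow> ?Jopt P"
    if \<omega>: "\<omega> \<in> space \<Omega>" and u: "\<forall>k::nat. \<forall>\<^sub>F n in sequentially. n \<ge> 1 \<and>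
      (\<forall>\<gamma>\<in>?A. \<bar>?J (?P n \<omega>) \<gamma> - ?J P \<gamma>\<bar> < 1 / real (Suc k))" for \<omega>
  proof (rule tendstoI)
    fix e :: real assume "e > 0"
    then obtain k where k: "1 / real (Suc k) < e" using nat_approx_posE by blast
    from u[rule_format, of k] show "\<forall>\<^sub>F n in sequentially. dist (?Jopt (?P n \<omega>)) (?Jopt P) < e"
    proof eventually_elim
      case (elim n)
      have "\<bar>?Jopt (?P n \<omega>) - ?Jopt P\<bar> \<le> 1 / real (Suc k)"
        using elim by (intro optimal_cost_close[OF P Pn[OF _ \<omega>]]) auto
      with k show ?case by (simp add: dist_real_def)
    qed
  qed
  show ?thesis
  proof (intro conjI allI impI)
    show "AE \<omega> in \<Omega>. (\<lambda>n. ?Jopt (?P n \<omega>)) \<longlonglongrightarrow> ?Jopt P"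
      using unif by eventually_elim (use opt_conv in blast)
  next
    fix \<gamma>_opt :: "nat \<Rightarrow> 'w \<Rightarrow> ('y, 'u) policy"
    assume opt: "\<forall>n\<ge>1. \<forall>\<omega>\<in>space \<Omega>. optimal_policy X Y U Q c \<beta> (?P n \<omega>) T (\<gamma>_opt n \<omega>)"
    from unif show "AE \<omega> in \<Omega>. (\<lambda>n. ?J P (\<gamma>_opt n \<omega>)) \<longlonglongrightarrow> ?Jopt P"
    proof eventually_elim
      case (elim \<omega>)
      then have \<omega>: "\<omega> \<in> space \<Omega>" and u: "\<forall>k::nat. \<forall>\<^sub>F n in sequentially. n \<ge> 1 \<and>
        (\<forall>\<gamma>\<in>?A. \<bar>?J (?P n \<omega>) \<gamma> - ?J P \<gamma>\<bar> < 1 / real (Suc k))" by auto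
      \<comment> \<open>By optimality the subtracted term is the cost of the same policy under the
        empirical prior, so the difference compares one policy under two priors. Uniformity over
        policies absorbs its dependence on n and \<omega>.\<close>
      have "(\<lambda>n. ?J P (\<gamma>_opt n \<omega>) - ?Jopt (?P n \<omega>)) \<longlonglongrightarrow> 0"
      proof (rule tendstoI)
        fix e :: real assume "e > 0"
        then obtain k where k: "1 / real (Suc k) < e" using nat_approx_posE by blast
        from u[rule_format, of k]
        show "\<forall>\<^sub>F n in sequentially. dist (?J P (\<gamma>_opt n \<omega>) - ?Jopt (?P n \<omega>)) 0 < e"
        proof eventually_elim
          case (elim n)
          then have "\<gamma>_opt n \<omega> \<in> ?A" "?J (?P n \<omega>) (\<gamma>_opt n \<omega>) = ?Jopt (?P n \<omega>)"
            using opt \<omega> by (auto simp: optimal_policy_def)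
          with elim k show ?case by (fastforce simp: dist_real_def)
        qed
      qed
      from tendsto_add[OF this opt_conv[OF \<omega> u]] show ?case by simp
    qed
  qed
qed

end
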